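(* The Brouwer degree for admissible triples in $\mathbb{R}^k$ satisfies the following three properties: (Normalization) $\deg(I,\mathbb{R}^k,0)=1$, where $I$ denotes the identity on $\mathbb{R}^k$. (Additivity) If $(f,U,y)$ is admissible, and $U_1$ and $U_2$ are two disjoint open subsets of $U$ such that $f^{-1}(y)\cap U\subseteq U_1\cup U_2$, then $$\deg(f,U,y)=\deg(f,U_1,y)+\deg(f,U_2,y).$$ (Homotopy Invariance) If $(H,U,\alpha)$ is an admissible homotopy, then $$\deg(H(\cdot,0),U,\alpha(0))=\deg(H(\cdot,1),U,\alpha(1)).$$
   Context: Here $k$ is a positive integer, all maps are assumed continuous, and $\overline U$, $\partial U$ denote the closure and boundary of $U$ in $\mathbb{R}^k$. A map between metric spaces is proper if preimages of compact sets are compact. A function on a subset $X$ of $\mathbb{R}^k$ is $C^\infty$ if it admits a $C^\infty$ extension to an open neighborhood of $X$. Triples: $(f,U,y)$ consists of an open set $U\subseteq\mathbb{R}^k$, an $\mathbb{R}^k$-valued map $f$ defined (at least) on $\overline U$, and $y\in\mathbb{R}^k$. It is admissible if $f$ is proper on $\overline U$ (i.e. $f|_{\overline U}$ is proper) and $f(x)\neq y$ for all $x\in\partial U$. It is regular if it is admissible, $f$ is $C^\infty$, and $\det f'(x)\ne0$ for all $x\in f^{-1}(y)\cap U$ (this set is then finite). Degree of a regular triple: $\deg(f,U,y):=\sum_{x\in f^{-1}(y)\cap U}\mathrm{i}(f,x)$, where $\mathrm{i}(f,x):=\mathrm{sign}(\det f'(x))$. Degree of an admissible triple: $\deg(f,U,y):=\deg(g,U,z)$,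 where $(g,U,z)$ is any regular triple for which there are $\epsilon,\sigma>0$ with $|g(x)-f(x)|\le\epsilon$ for all $x\in\overline U$, $|z-y|\le\sigma$, and $\epsilon+\sigma<\mathrm{dist}(y,f(\partial U))$ (convention: $\mathrm{dist}(y,\emptyset)=+\infty$). Such regular triples exist and the value does not depend on the choice. Homotopies: $(H,U,\alpha)$, where $U\subseteq\mathbb{R}^k$ is open, $H$ is an $\mathbb{R}^k$-valued map defined (at least) on $\overline U\times[0,1]$ and $\alpha:[0,1]\to\mathbb{R}^k$ is a path, is an admissible homotopy if $H$ is proper on $\overline U\times[0,1]$ and $H(x,\lambda)\neq\alpha(\lambda)$ for all $(x,\lambda)\in\partial U\times[0,1]$. *)

theory Defs
  imports "HOL-Analysis.Analysis"
begin

text \<open>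
  Maps defined on a subset of \<open>\<real>\<^sup>k\<close> are modelled by total functions whose values outside
  the relevant set are irrelevant; \<open>\<real>\<^sup>k\<close> is \<^typ>\<open>real ^ 'k\<close> with \<^typ>\<open>'k::finite\<close>,
  so that \<open>k \<ge> 1\<close> is arbitrary.
\<close>

definition proper_on :: "'a::metric_space set \<Rightarrow> ('a \<Rightarrow> 'b::metric_space) \<Rightarrow> bool" where
  "proper_on X f \<longleftrightarrow> (\<forall>K. compact K \<longrightarrow> compact (X \<inter> f -` K))"

text \<open>\<open>C\<^sup>n\<close> on an open set: all iterated directional derivatives up to order \<open>n\<close> exist and
  are continuous, with (total) differentiability at every stage.\<close>

primrec Cn_on :: "nat \<Rightarrow> 'a::real_normed_vector set \<Rightarrow> ('a \<Rightarrow> 'b::real_normed_vector) \<Rightarrow> bool" where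
  "Cn_on 0 V f \<longleftrightarrow> continuous_on V f"
| "Cn_on (Suc n) V f \<longleftrightarrow>
     (\<forall>x\<in>V. f differentiable (at x)) \<and>
     (\<forall>v. Cn_on n V (\<lambda>x. frechet_derivative f (at x) v))"

definition smooth_on :: "'a::real_normed_vector set \<Rightarrow> ('a \<Rightarrow> 'b::real_normed_vector) \<Rightarrow> bool" where
  "smooth_on X f \<longleftrightarrow>
     (\<exists>V h. open V \<and> X \<subseteq> V \<and> (\<forall>n. Cn_on n V h) \<and> (\<forall>x\<in>X. h x = f x))"

definition admissible ::
  "(real ^ 'k \<Rightarrow> real ^ 'k) \<Rightarrow> (real ^ 'k) set \<Rightarrow> real ^ 'k \<Rightarrow> bool" where
  "admissible f U y \<longleftrightarrow>
     open U \<and> continuous_on (closure U) f \<and> proper_on (closure U) f \<and>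
     (\<forall>x\<in>frontier U. f x \<noteq> y)"

text \<open>The derivative is only ever taken at points \<open>x\<close> of the open set \<open>U\<close>, where it does not
  depend on the values of \<open>f\<close> outside \<open>U\<close>.\<close>

definition jacobian_det :: "(real ^ 'k \<Rightarrow> real ^ 'k) \<Rightarrow> real ^ 'k \<Rightarrow> real" where
  "jacobian_det f x = det (jacobian f (at x))"

definition regular ::
  "(real ^ 'k \<Rightarrow> real ^ 'k) \<Rightarrow> (real ^ 'k) set \<Rightarrow> real ^ 'k \<Rightarrow> bool" where
  "regular f U y \<longleftrightarrow>
     admissible f U y \<and> smooth_on (closure U) f \<and>
     (\<forall>x \<in> f -` {y} \<inter> U. jacobian_det f x \<noteq> 0)"

definition local_index :: "(real ^ 'k \<Rightarrow> real ^ 'k) \<Rightarrow> real ^ 'k \<Rightarrow> int" where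
  "local_index f x =
     (if jacobian_det f x > 0 then 1 else if jacobian_det f x < 0 then - 1 else 0)"

definition regular_degree ::
  "(real ^ 'k \<Rightarrow> real ^ 'k) \<Rightarrow> (real ^ 'k) set \<Rightarrow> real ^ 'k \<Rightarrow> int" where
  "regular_degree f U y = (\<Sum>x \<in> f -` {y} \<inter> U. local_index f x)"

text \<open>\<open>(g, U, z)\<close> is close enough to \<open>(f, U, y)\<close> to compute its degree. The case distinction
  implements \<open>dist(y, \<emptyset>) = +\<infinity>\<close>, whereas \<^const>\<open>infdist\<close> to the empty set is \<open>0\<close>.\<close>

definition degree_approx ::
  "(real ^ 'k \<Rightarrow> real ^ 'k) \<Rightarrow> (real ^ 'k) set \<Rightarrow> real ^ 'k \<Rightarrow>
   (real ^ 'k \<Rightarrow> real ^ 'k) \<Rightarrow> real ^ 'k \<Rightarrow> bool" where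
  "degree_approx f U y g z \<longleftrightarrow>
     (\<exists>\<epsilon> \<sigma>. \<epsilon> > 0 \<and> \<sigma> > 0 \<and>
        (\<forall>x\<in>closure U. norm (g x - f x) \<le> \<epsilon>) \<and> norm (z - y) \<le> \<sigma> \<and>
        (frontier U = {} \<or> \<epsilon> + \<sigma> < infdist y (f ` frontier U)))"

text \<open>For admissible triples the value below exists and is unique.\<close>

definition brouwer_deg ::
  "(real ^ 'k \<Rightarrow> real ^ 'k) \<Rightarrow> (real ^ 'k) set \<Rightarrow> real ^ 'k \<Rightarrow> int" where
  "brouwer_deg f U y =
     (THE d. \<exists>g z. regular g U z \<and> degree_approx f U y g z \<and> d = regular_degree g U z)"

definition admissible_homotopy ::
  "((real ^ 'k) \<times> real \<Rightarrow> real ^ 'k) \<Rightarrow> (real ^ 'k) set \<Rightarrow> (real \<Rightarrow> real ^ 'k) \<Rightarrow> bool" where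
  "admissible_homotopy H U \<alpha> \<longleftrightarrow>
     open U \<and> path \<alpha> \<and>
     continuous_on (closure U \<times> {0..1}) H \<and> proper_on (closure U \<times> {0..1}) H \<and>
     (\<forall>x\<in>frontier U. \<forall>t\<in>{0..1}. H (x, t) \<noteq> \<alpha> t)"

end

(*
  For a bump function phi supported near 0, the integral of phi (G x) * det G'(x) does not change along a
  line homotopy that stays away from the support of phi outside a compact set: the t-derivative of the
  integrand is a divergence, because the rows of the cofactor matrix of a Jacobian are divergence-free.
  When phi is radial and 0 is a regular value of G, this integral is the sum of the local indices times
  the integral of phi.  Indeed, homotopies localize it to balls around the zeros and replace G there by its
  linearization, and elementary row operations join an invertible matrix, within the invertible ones,
  to an isometry, for which the value is evident.  Hence close regular triples have the same degree.

  Regular approximations on a possibly unbounded closure come from Weierstrass polynomials glued on annuli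
  by smooth step functions, followed by Sard's theorem.  Additivity holds for a regular approximation
  that is close on U, U1 and U2 at once.  For homotopy invariance, additivity first shrinks U to a bounded
  set, where uniform continuity makes the degree locally constant in time.
*)
theory Submission
  imports Defs
begin

section \<open>Determinants and integrals of derivatives\<close>

text \<open>Two regular approximations of one triple are joined by a straight line, but zeros along
  that line may degenerate, so zeros cannot be counted at intermediate times. The integral does not
  notice this: it asks for \<open>C^2\<close> maps, a \<open>C^1\<close> bump, and a compact set
  outside which the whole homotopy has norm at least \<open>\<rho>\<close>. Regularity enters at the
  two ends alone. The factor \<open>integral UNIV (bump \<rho>)\<close> is positive and common to
  both ends, so it cancels and is never computed; and a radial bump composed with an isometry is the
  same bump, so isometries need no change of variables. As \<open>U\<close> may be unbounded,
  compactness comes from properness: sublevel sets of the distance from \<open>f\<close> to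
  \<open>y\<close> are compact, and they lie in \<open>U\<close> while the level stays below the
  distance on the frontier. Comparing \<open>g - z\<close> with \<open>f - y\<close> puts the target
  at the origin and merges two tolerances into one.\<close>

lemma has_real_derivative_det:
  fixes B :: "real \<Rightarrow> real^'n^'n"
  assumes "\<And>i j. ((\<lambda>s. B s $ i $ j) has_real_derivative B' $ i $ j) (at s within T)"
  shows "((\<lambda>s. det (B s)) has_real_derivative
    (\<Sum>i\<in>UNIV. det (\<chi> r. if r = i then B' $ i else B s $ r))) (at s within T)"
proof -
  have der: "((\<lambda>s. B s $ i $ j) has_derivative (\<lambda>h. B' $ i $ j * h)) (at s within T)" for i j
    using assms[of i j] by (simp add: has_field_derivative_def)
  have P: "((\<lambda>s. \<Prod>i\<in>UNIV. B s $ i $ p i) has_derivative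
      (\<lambda>h. \<Sum>i\<in>UNIV. (B' $ i $ p i * h) * (\<Prod>j\<in>UNIV - {i}. B s $ j $ p j))) (at s within T)" for p
    by (intro has_derivative_prod der)
  have row: "(\<Prod>r\<in>UNIV. (\<chi> r. if r = i then B' $ i else B s $ r) $ r $ p r)
      = B' $ i $ p i * (\<Prod>j\<in>UNIV - {i}. B s $ j $ p j)" for i and p :: "'n \<Rightarrow> 'n"
    by (subst prod.remove[of UNIV i]) (auto intro!: prod.cong)
  have Q: "((\<lambda>s. \<Prod>i\<in>UNIV. B s $ i $ p i) has_real_derivative
      (\<Sum>i\<in>UNIV. \<Prod>r\<in>UNIV. (\<chi> r. if r = i then B' $ i else B s $ r) $ r $ p r)) (at s within T)" for p
    unfolding has_field_derivative_def row
    by (rule has_derivative_eq_rhs[OF P], rule ext, unfold sum_distrib_right, intro sum.cong refl) (simp only: mult_ac)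
  have "((\<lambda>s. det (B s)) has_real_derivative
    (\<Sum>p\<in>{p. p permutes UNIV}. of_int (sign p) *
       (\<Sum>i\<in>UNIV. \<Prod>r\<in>UNIV. (\<chi> r. if r = i then B' $ i else B s $ r) $ r $ p r))) (at s within T)"
    unfolding det_def by (intro DERIV_sum DERIV_cmult Q)
  also have "(\<Sum>p\<in>{p. p permutes UNIV}. of_int (sign p) *
       (\<Sum>i\<in>UNIV. \<Prod>r\<in>UNIV. (\<chi> r. if r = i then B' $ i else B s $ r) $ r $ p r))
     = (\<Sum>i\<in>UNIV. det (\<chi> r. if r = i then B' $ i else B s $ r))"
    unfolding det_def sum_distrib_left by (rule sum.swap)
  finally show ?thesis .
qed

text \<open>Cofactor expansion along row \<open>i\<close>. The cofactor is kept as a determinant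
  with a unit row instead of a minor, so matrices never change size and the row lemmas also apply to
  derivatives of cofactors.\<close>

lemma det_row_expand:
  fixes v :: "real^'n" and c :: "'n \<Rightarrow> real^'n"
  shows "det (\<chi> r. if r = i then v else c r) = (\<Sum>j\<in>UNIV. v $ j * det (\<chi> r. if r = i then axis j 1 else c r))"
proof -
  have "det (\<chi> r. if r = i then v else c r) = det (\<chi> r. if r = i then (\<Sum>j\<in>UNIV. v $ j *s axis j 1) else c r)"
    by (simp only: basis_expansion)
  also have "\<dots> = (\<Sum>j\<in>UNIV. det (\<chi> r. if r = i then v $ j *s axis j 1 else c r))"
    using det_linear_row_sum[of UNIV i "\<lambda>_ j. v $ j *s axis j 1" c] by simp
  also have "\<dots> = (\<Sum>j\<in>UNIV. v $ j * det (\<chi> r. if r = i then axis j 1 else c r))"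
    by (intro sum.cong refl) (rule det_row_mul[of i _ "\<lambda>_. axis _ 1" c])
  finally show ?thesis .
qed

text \<open>Multilinearity leaves one term per \<open>l\<close>, and each term with
  \<open>l \<noteq> i\<close> has two equal rows. Used for the gradient of a function composed with
  a map, which is a combination of the rows of the Jacobian.\<close>

lemma det_row_combination:
  fixes A :: "real^'n^'n"
  shows "det (\<chi> r. if r = i then (\<Sum>l\<in>UNIV. c l *s A $ l) else A $ r) = c i * det A"
proof -
  have "det (\<chi> r. if r = i then (\<Sum>l\<in>UNIV. c l *s A $ l) else A $ r)
      = (\<Sum>l\<in>UNIV. det (\<chi> r. if r = i then c l *s A $ l else A $ r))"
    using det_linear_row_sum[of UNIV i "\<lambda>_ l. c l *s A $ l" "($) A"] by simp
  also have "\<dots> = (\<Sum>l\<in>UNIV. c l * det (\<chi> r. if r = i then A $ l else A $ r))"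
    by (intro sum.cong refl) (rule det_row_mul[of i _ "\<lambda>_. A $ _" "($) A"])
  also have "\<dots> = (\<Sum>l\<in>UNIV. if l = i then c i * det A else 0)"
  proof (intro sum.cong refl)
    fix l
    show "c l * det (\<chi> r. if r = i then A $ l else A $ r) = (if l = i then c i * det A else 0)"
    proof (cases "l = i")
      case True
      have "(\<chi> r. if r = i then A $ l else A $ r) = A" using True by (simp add: vec_eq_iff)
      then show ?thesis using True by simp
    next
      case False
      have "det (\<chi> r. if r = i then A $ l else A $ r) = 0"
        using False by (intro det_identical_rows[of i l]) (auto simp: row_def)
      then show ?thesis using False by simp
    qed
  qed
  finally show ?thesis by simp
qed

text \<open>Polarization: the form vanishes when both rows are \<open>u + v\<close>, and expanding
  this leaves the two mixed terms.\<close>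

lemma det_two_rows_swap:
  fixes c :: "'n \<Rightarrow> real^'n"
  assumes "i \<noteq> l"
  shows "det (\<chi> r. if r = l then v else if r = i then u else c r)
       = - det (\<chi> r. if r = l then u else if r = i then v else c r)"
proof -
  let ?D = "\<lambda>u v. det (\<chi> r. if r = l then v else if r = i then u else c r)"
  have zero: "?D u u = 0" for u
    using assms by (intro det_identical_rows[of i l]) (auto simp: row_def)
  have add1: "?D (u + u') v = ?D u v + ?D u' v" for u u' v
  proof -
    have *: "(\<chi> r. if r = l then v else if r = i then x else c r) = 
       (\<chi> r. if r = i then x else if r = l then v else c r)" for x
      using assms by (auto simp: vec_eq_iff)
    show ?thesis unfolding * using det_row_add[of i "\<lambda>_. u" "\<lambda>_. u'" "\<lambda>r. if r = l then v else c r"] by simp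
  qed
  have add2: "?D u (v + v') = ?D u v + ?D u v'" for u v v'
    using det_row_add[of l "\<lambda>_. v" "\<lambda>_. v'" "\<lambda>r. if r = i then u else c r"] by simp
  have "0 = ?D (u + v) (u + v)" using zero by simp
  also have "\<dots> = ?D u v + ?D v u" unfolding add1 add2 by (simp add: zero)
  finally show ?thesis by simp
qed

text \<open>The antisymmetry of the determinant against the symmetry of the Hessian is what makes
  the rows of the cofactor matrix of a Jacobian divergence-free.\<close>

lemma sum_det_symmetric_eq_0:
  fixes c :: "'n \<Rightarrow> real^'n" and b :: "'n \<Rightarrow> 'n \<Rightarrow> real"
  assumes "i \<noteq> l" and sym: "\<And>j m. b j m = b m j"
  shows "(\<Sum>j\<in>UNIV. det (\<chi> r. if r = l then (\<chi> m. b m j) else if r = i then axis j 1 else c r)) = 0"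
proof -
  let ?D = "\<lambda>j m. det (\<chi> r. if r = l then axis m 1 else if r = i then axis j 1 else c r)"
  let ?S = "\<Sum>j\<in>UNIV. \<Sum>m\<in>UNIV. b m j * ?D j m"
  have "(\<Sum>j\<in>UNIV. det (\<chi> r. if r = l then (\<chi> m. b m j) else if r = i then axis j 1 else c r)) = ?S"
    by (subst det_row_expand) simp
  moreover have "?S = - ?S"
  proof -
    have "?S = (\<Sum>m\<in>UNIV. \<Sum>j\<in>UNIV. b m j * ?D j m)" by (rule sum.swap)
    also have "\<dots> = (\<Sum>m\<in>UNIV. \<Sum>j\<in>UNIV. - (b j m * ?D m j))"

    proof (intro sum.cong refl)
      fix m j
      have "?D j m = - ?D m j" by (rule det_two_rows_swap[OF assms(1)])
      then show "b m j * ?D j m = - (b j m * ?D m j)" using sym[of m j] by simp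
    qed
    finally show ?thesis by (simp add: sum_negf)
  qed
  ultimately show ?thesis by simp
qed

section \<open>Integration of compactly supported functions\<close>

lemma continuous_on_extend_zero:
  fixes u :: "'a::t2_space \<Rightarrow> real"
  assumes "open U" "compact K" "K \<subseteq> U" "continuous_on U u" "\<And>x. x \<in> U - K \<Longrightarrow> u x = 0"
  shows "continuous_on UNIV (\<lambda>x. if x \<in> U then u x else 0)"
proof -
  have "continuous_on U (\<lambda>x. if x \<in> U then u x else 0)"
    using assms(4) by (simp cong: continuous_on_cong)
  moreover have "continuous_on (- K) (\<lambda>x. if x \<in> U then u x else 0)"
    using assms(5) by (intro continuous_on_eq[OF continuous_on_const[of _ 0]]) auto
  ultimately have "continuous_on (U \<union> - K) (\<lambda>x. if x \<in> U then u x else 0)"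
    using assms by (intro continuous_on_open_Un) (auto simp: compact_imp_closed open_Compl)
  moreover have "U \<union> - K = UNIV" using assms by auto
  ultimately show ?thesis by simp
qed

lemma integrable_extend_zero:
  fixes u :: "'a::euclidean_space \<Rightarrow> real"
  assumes "open U" "compact K" "K \<subseteq> U" "continuous_on U u" "\<And>x. x \<in> U - K \<Longrightarrow> u x = 0"
  shows "u integrable_on U"
proof -
  obtain a b where ab: "K \<subseteq> cbox a b"
    using bounded_subset_cbox_symmetric compact_imp_bounded[OF assms(2)] by metis
  let ?u = "\<lambda>x. if x \<in> U then u x else 0"
  have "?u integrable_on cbox a b"
    using continuous_on_extend_zero[OF assms] by (blast intro: integrable_continuous continuous_on_subset)
  then have "(\<lambda>x. if x \<in> cbox a b then ?u x else 0) integrable_on UNIV"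
    by (simp add: integrable_restrict_UNIV)
  moreover have "(\<lambda>x. if x \<in> cbox a b then ?u x else 0) = ?u"
    using ab assms(5) by (auto simp: fun_eq_iff)
  ultimately show ?thesis by (simp add: integrable_restrict_UNIV)
qed

lemma integral_extend_zero_cbox:
  fixes u :: "'a::euclidean_space \<Rightarrow> real"
  assumes "K \<subseteq> cbox a b" "\<And>x. x \<in> U - K \<Longrightarrow> u x = 0"
  shows "integral (cbox a b) (\<lambda>x. if x \<in> U then u x else 0) = integral U u"
proof -
  have "integral (cbox a b) (\<lambda>x. if x \<in> U then u x else 0)
     = integral UNIV (\<lambda>x. if x \<in> cbox a b then if x \<in> U then u x else 0 else 0)"
    by (simp add: integral_restrict_UNIV)
  also have "(\<lambda>x. if x \<in> cbox a b then if x \<in> U then u x else 0 else 0) = (\<lambda>x. if x \<in> U then u x else 0)"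
    using assms by (auto simp: fun_eq_iff)
  finally show ?thesis by (simp add: integral_restrict_UNIV)
qed

lemma DERIV_line_shift:
  fixes x e :: "'a::real_vector"
  assumes "((\<lambda>t. f ((x + s *\<^sub>R e) + t *\<^sub>R e)) has_real_derivative d) (at 0)"
  shows "((\<lambda>t. f (x + t *\<^sub>R e)) has_real_derivative d) (at s)"
proof -
  have "((\<lambda>t. f (x + (t + s) *\<^sub>R e)) has_real_derivative d) (at 0)"
    using assms by (simp add: algebra_simps)
  then show ?thesis using DERIV_shift[of "\<lambda>r. f (x + r *\<^sub>R e)" d 0 s] by simp
qed

text \<open>Translating a function with compact support does not change its integral, so
  differentiating that integral in the length of the translation gives zero. This stands in for the
  divergence theorem: it is later applied to each component of a vector field. The second conclusion
  makes \<open>d\<close> integrable over \<open>U\<close>.\<close>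

lemma integral_directional_derivative_eq_0:
  fixes u d :: "'a::euclidean_space \<Rightarrow> real"
  assumes U: "open U" and K: "compact K" "K \<subseteq> U"
    and u: "continuous_on U u" "\<And>x. x \<in> U - K \<Longrightarrow> u x = 0"
    and d: "continuous_on U d"
    and der: "\<And>x. x \<in> U \<Longrightarrow> ((\<lambda>s. u (x + s *\<^sub>R e)) has_real_derivative d x) (at 0)"
  shows "integral U d = 0" and "\<And>x. x \<in> U - K \<Longrightarrow> d x = 0"
proof -
  define u' where "u' = (\<lambda>x. if x \<in> U then u x else 0)"
  define d' where "d' = (\<lambda>x. if x \<in> U then d x else 0)"
  have opK: "open (- K)" using K by (simp add: compact_imp_closed open_Compl)
  have near: "\<forall>\<^sub>F s in nhds (0::real). x + s *\<^sub>R e \<in> V" if "x \<in> V" "open V" for x V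
  proof -
    have "((\<lambda>s. x + s *\<^sub>R e) \<longlongrightarrow> x + 0 *\<^sub>R e) (nhds 0)" by (intro tendsto_intros filterlim_ident)
    then show ?thesis using that by (simp add: tendsto_def)
  qed
  have der0: "((\<lambda>s. u' (x + s *\<^sub>R e)) has_real_derivative 0) (at 0)" if "x \<notin> K" for x
  proof -
    have "\<forall>\<^sub>F s in nhds 0. u' (x + s *\<^sub>R e) = 0"
      using near[of x "- K"] that opK u(2) unfolding u'_def by (auto elim!: eventually_mono)
    then show ?thesis by (subst DERIV_cong_ev[OF refl _ refl, where g = "\<lambda>_. 0"]) auto
  qed
  have derU: "((\<lambda>s. u' (x + s *\<^sub>R e)) has_real_derivative d x) (at 0)" if "x \<in> U" for x
  proof -
    have "\<forall>\<^sub>F s in nhds 0. u' (x + s *\<^sub>R e) = u (x + s *\<^sub>R e)"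
      using near[of x U] that U unfolding u'_def by (auto elim!: eventually_mono)
    then show ?thesis using der[OF that] by (subst DERIV_cong_ev[OF refl _ refl]) auto
  qed
  show d0: "d x = 0" if "x \<in> U - K" for x
    using der0[of x] derU[of x] that DERIV_unique by blast
  have der': "((\<lambda>s. u' (x + s *\<^sub>R e)) has_real_derivative d' x) (at 0)" for x
    using der0[of x] derU[of x] d0[of x] K unfolding d'_def by auto
  have der'': "((\<lambda>s. u' (x + s *\<^sub>R e)) has_real_derivative d' (x + s *\<^sub>R e)) (at s)" for x s
    by (rule DERIV_line_shift) (rule der')
  have cu: "continuous_on UNIV u'" unfolding u'_def by (rule continuous_on_extend_zero[OF U K u])
  have cd: "continuous_on UNIV d'" unfolding d'_def by (rule continuous_on_extend_zero[OF U K d d0])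
  \<comment> \<open>A box that holds every translate of \<open>K\<close> by
    \<open>s *\<^sub>R e\<close> with \<open>\<bar>s\<bar> \<le> 1\<close>, so that integration over
    this fixed box sees the whole support for all small \<open>s\<close>.\<close>
  have "bounded ((\<lambda>(x,s). x + s *\<^sub>R e) ` (K \<times> {-1..1::real}))"
    using K by (intro compact_imp_bounded compact_continuous_image compact_Times)
      (auto simp: split_beta intro!: continuous_intros)
  then obtain a where a: "(\<lambda>(x,s). x + s *\<^sub>R e) ` (K \<times> {-1..1::real}) \<subseteq> cbox (-a) a"
    using bounded_subset_cbox_symmetric by metis
  have aK: "x + s *\<^sub>R e \<in> cbox (-a) a" if "x \<in> K" "\<bar>s\<bar> \<le> 1" for x s
  proof -
    have "s \<in> {-1..1}" using that by auto
    then show ?thesis using a that by (auto simp: image_subset_iff simp del: atLeastAtMost_iff)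
  qed
  have uK: "u' x = 0" if "x \<notin> K" for x using that u(2) by (auto simp: u'_def)
  have const: "integral (cbox (-a) a) (\<lambda>x. u' (x + s *\<^sub>R e)) = integral UNIV u'" if "\<bar>s\<bar> \<le> 1" for s
  proof -
    have "integral (cbox (-a) a) (\<lambda>x. u' (x + s *\<^sub>R e)) = integral (cbox (-a + s *\<^sub>R e) (a + s *\<^sub>R e)) u'"
      using integral_shift_cbox[of "-a + s *\<^sub>R e" "s *\<^sub>R e" "a + s *\<^sub>R e" u'] by simp
    also have "\<dots> = integral UNIV (\<lambda>x. if x \<in> cbox (-a + s *\<^sub>R e) (a + s *\<^sub>R e) then u' x else 0)"
      by (simp add: integral_restrict_UNIV)
    also have "(\<lambda>x. if x \<in> cbox (-a + s *\<^sub>R e) (a + s *\<^sub>R e) then u' x else 0) = u'"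
    proof
      fix x
      have "x \<in> cbox (-a + s *\<^sub>R e) (a + s *\<^sub>R e)" if "x \<in> K"
        using aK[of x "-s"] that \<open>\<bar>s\<bar> \<le> 1\<close> by (simp add: mem_box algebra_simps)
      then show "(if x \<in> cbox (-a + s *\<^sub>R e) (a + s *\<^sub>R e) then u' x else 0) = u' x"
        using uK[of x] by auto
    qed
    finally show ?thesis .
  qed
  have "((\<lambda>s. integral (cbox (-a) a) (\<lambda>x. u' (x + s *\<^sub>R e))) has_real_derivative
         integral (cbox (-a) a) (\<lambda>x. d' (x + 0 *\<^sub>R e))) (at 0 within {-1<..<1})"
  proof (rule leibniz_rule_field_derivative[where fx = "\<lambda>s x. d' (x + s *\<^sub>R e)"])
    show "continuous_on ({- 1<..<1} \<times> cbox (- a) a) (\<lambda>(s, x). d' (x + s *\<^sub>R e))"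
      unfolding split_beta by (intro continuous_on_compose2[OF cd] continuous_intros) auto
    show "(\<lambda>x. u' (x + s *\<^sub>R e)) integrable_on cbox (-a) a" for s
      by (intro integrable_continuous continuous_on_compose2[OF cu] continuous_intros) auto
  qed (auto intro: has_field_derivative_at_within der'')
  then have D1: "((\<lambda>s. integral (cbox (-a) a) (\<lambda>x. u' (x + s *\<^sub>R e))) has_real_derivative
         integral (cbox (-a) a) d') (at 0)"
    by (simp add: at_within_open[of 0 "{-1<..<1::real}"])
  have "\<forall>\<^sub>F s in nhds (0::real). s \<in> {-1<..<1}" by (intro eventually_nhds_in_open) auto
  then have "\<forall>\<^sub>F s in nhds 0. integral (cbox (-a) a) (\<lambda>x. u' (x + s *\<^sub>R e)) = integral UNIV u'"
    by (rule eventually_mono) (intro const, auto)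
  then have D2: "((\<lambda>s. integral (cbox (-a) a) (\<lambda>x. u' (x + s *\<^sub>R e))) has_real_derivative 0) (at 0)"
    by (subst DERIV_cong_ev[OF refl _ refl, where g = "\<lambda>_. integral UNIV u'"]) auto
  have "integral (cbox (-a) a) d' = 0" using DERIV_unique[OF D1 D2] .
  moreover have "integral (cbox (-a) a) d' = integral U d"
    unfolding d'_def by (rule integral_extend_zero_cbox[of K]) (use aK[of _ 0] d0 in auto)
  ultimately show "integral U d = 0" by simp
qed

section \<open>Smooth functions\<close>

lemma Cn_on_subset: "Cn_on n V f \<Longrightarrow> W \<subseteq> V \<Longrightarrow> Cn_on n W f"
  by (induction n arbitrary: f) (auto intro: continuous_on_subset)

lemma Cn_on_cong:
  "open V \<Longrightarrow> (\<And>x. x \<in> V \<Longrightarrow> f x = g x) \<Longrightarrow> Cn_on n V f \<Longrightarrow> Cn_on n V g"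
proof (induction n arbitrary: f g)
  case 0
  then show ?case by (simp add: continuous_on_eq)
next
  case (Suc n)
  have eq: "frechet_derivative f (at x) = frechet_derivative g (at x)" if "x \<in> V" for x
    using Suc.prems that by (intro frechet_derivative_transform_within_open[of _ _ V]) auto
  have "g differentiable (at x)" if "x \<in> V" for x
    using Suc.prems that unfolding differentiable_def
    by (metis Cn_on.simps(2) differentiable_def has_derivative_transform_within_open)
  moreover have "Cn_on n V (\<lambda>x. frechet_derivative g (at x) v)" for v
    using Suc.IH[OF \<open>open V\<close>, of "\<lambda>x. frechet_derivative f (at x) v" "\<lambda>x. frechet_derivative g (at x) v"]
      eq Suc.prems by simp
  ultimately show ?case by simp
qed

lemma Cn_on_SucD: "Cn_on (Suc n) V f \<Longrightarrow> Cn_on n V f"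
proof (induction n arbitrary: f)
  case 0
  then show ?case
    by (auto intro!: continuous_at_imp_continuous_on differentiable_imp_continuous_within)
next
  case (Suc n)
  then show ?case by simp
qed

text \<open>\<open>Cn_on\<close> is phrased with the chosen derivative
  \<open>frechet_derivative\<close>; uniqueness of derivatives allows any explicit formula in its
  place.\<close>

lemma Cn_on_SucI:
  assumes "open V" "\<And>x. x \<in> V \<Longrightarrow> (f has_derivative f' x) (at x)" "\<And>v. Cn_on n V (\<lambda>x. f' x v)"
  shows "Cn_on (Suc n) V f"
proof -
  have "frechet_derivative f (at x) = f' x" if "x \<in> V" for x
    using frechet_derivative_at[OF assms(2)[OF that]] by simp
  then have "Cn_on n V (\<lambda>x. frechet_derivative f (at x) v)" for v
    by (intro Cn_on_cong[OF assms(1) _ assms(3)[of v]]) simp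
  then show ?thesis using assms(2) by (auto simp: differentiable_def)
qed

lemma Cn_on_SucE:
  assumes "Cn_on (Suc n) V f"
  shows "x \<in> V \<Longrightarrow> (f has_derivative frechet_derivative f (at x)) (at x)"
    and "Cn_on n V (\<lambda>x. frechet_derivative f (at x) v)"
  using assms by (auto simp: frechet_derivative_works[symmetric])

lemma Cn_on_const: "Cn_on n V (\<lambda>x. c)"
  by (induction n arbitrary: c) simp_all

lemma Cn_on_bounded_linear:
  assumes "open V" "bounded_linear f"
  shows "Cn_on n V f"
proof (cases n)
  case 0
  then show ?thesis using assms by (simp add: linear_continuous_on)
next
  case (Suc m)
  show ?thesis unfolding Suc
    by (rule Cn_on_SucI[OF assms(1), where f' = "\<lambda>_. f"])
      (auto intro: Cn_on_const bounded_linear_imp_has_derivative assms)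
qed

lemma Cn_on_add:
  assumes "open V"
  shows "Cn_on n V f \<Longrightarrow> Cn_on n V g \<Longrightarrow> Cn_on n V (\<lambda>x. f x + g x)"
proof (induction n arbitrary: f g)
  case 0
  then show ?case by (simp add: continuous_on_add)
next
  case (Suc n)
  show ?case
    by (rule Cn_on_SucI[OF assms has_derivative_add[OF Cn_on_SucE(1)[OF Suc.prems(1)] Cn_on_SucE(1)[OF Suc.prems(2)]]])
      (auto intro: Suc.IH Cn_on_SucE(2)[OF Suc.prems(1)] Cn_on_SucE(2)[OF Suc.prems(2)])
qed

lemma Cn_on_scaleR:
  assumes "open V"
  shows "Cn_on n V f \<Longrightarrow> Cn_on n V g \<Longrightarrow> Cn_on n V (\<lambda>x. f x *\<^sub>R g x)"
proof (induction n arbitrary: f g)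
  case 0
  then show ?case by (simp add: continuous_on_scaleR)
next
  case (Suc n)
  show ?case
    by (rule Cn_on_SucI[OF assms has_derivative_scaleR[OF Cn_on_SucE(1)[OF Suc.prems(1)] Cn_on_SucE(1)[OF Suc.prems(2)]]])
      (auto intro!: Cn_on_add[OF assms] Suc.IH intro: Cn_on_SucD Suc.prems Cn_on_SucE(2)[OF Suc.prems(1)] Cn_on_SucE(2)[OF Suc.prems(2)])
qed

lemma Cn_on_mult:
  fixes f g :: "'a::real_normed_vector \<Rightarrow> real"
  shows "open V \<Longrightarrow> Cn_on n V f \<Longrightarrow> Cn_on n V g \<Longrightarrow> Cn_on n V (\<lambda>x. f x * g x)"
  using Cn_on_scaleR[of V n f g] by simp

lemma Cn_on_diff:
  assumes "open V" "Cn_on n V f" "Cn_on n V g"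
  shows "Cn_on n V (\<lambda>x. f x - g x)"
  using Cn_on_add[OF assms(1,2) Cn_on_scaleR[OF assms(1) Cn_on_const[of _ _ "-1"] assms(3)]] by simp

lemma Cn_on_sum:
  assumes "open V" "finite I" "\<And>i. i \<in> I \<Longrightarrow> Cn_on n V (f i)"
  shows "Cn_on n V (\<lambda>x. \<Sum>i\<in>I. f i x)"
  using assms(2,3) by (induction I rule: finite_induct) (auto intro: Cn_on_const Cn_on_add[OF assms(1)])

text \<open>Derivatives are taken with \<open>at x\<close> and not within a set, so the property is
  local: it suffices to agree with a smooth function on each set of an open cover.\<close>

lemma Cn_on_UN:
  assumes "\<And>i. open (A i)" "\<And>i. Cn_on n (A i) f"
  shows "Cn_on n (\<Union>i. A i) f"
  using assms(2)
proof (induction n arbitrary: f)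
  case 0
  then show ?case using assms(1) by (auto intro!: continuous_on_open_UN)
qed auto

lemma Cn_on_real_polynomial_function:
  assumes "open V" "real_polynomial_function f"
  shows "Cn_on n V f"
  using assms(2)
  by induction (auto intro: Cn_on_const Cn_on_add Cn_on_mult Cn_on_bounded_linear assms(1))

lemma Cn_on_polynomial_function:
  fixes f :: "'a::euclidean_space \<Rightarrow> 'b::euclidean_space"
  assumes "open V" "polynomial_function f"
  shows "Cn_on n V f"
proof -
  have "Cn_on n V (\<lambda>x. \<Sum>b\<in>Basis. (f x \<bullet> b) *\<^sub>R b)"
  proof (intro Cn_on_sum Cn_on_scaleR Cn_on_const Cn_on_real_polynomial_function assms(1))
    fix b :: 'b
    show "real_polynomial_function (\<lambda>x. f x \<bullet> b)"
      using assms(2) bounded_linear_inner_left unfolding polynomial_function_def o_def by blast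
  qed auto
  then show ?thesis by (simp add: euclidean_representation)
qed

section \<open>A smooth step function\<close>

definition flat_exp :: "real poly \<Rightarrow> real \<Rightarrow> real" where
  "flat_exp p x = (if x > 0 then poly p (1 / x) * exp (- (1 / x)) else 0)"

lemma poly_exp_tendsto_0: "((\<lambda>t::real. poly p t * exp (- t)) \<longlongrightarrow> 0) at_top"
proof -
  have "((\<lambda>t. \<Sum>i\<le>degree p. coeff p i * (t ^ i / exp t)) \<longlongrightarrow> (\<Sum>i\<le>degree p. coeff p i * 0)) at_top"
    by (intro tendsto_intros tendsto_power_div_exp_0)
  then show ?thesis
    by (simp add: poly_altdef sum_distrib_right exp_minus divide_inverse mult.assoc)
qed

text \<open>With \<open>t = 1 / x\<close>, differentiating \<open>p(t) exp(-t)\<close> in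
  \<open>x\<close> gives \<open>t^2 (p(t) - p'(t)) exp(-t)\<close>. The family is closed under
  differentiation, so smoothness of all orders is a single induction over arbitrary
  \<open>p\<close>.\<close>

lemma has_real_derivative_flat_exp:
  "(flat_exp p has_real_derivative flat_exp ([:0, 0, 1:] * (p - pderiv p)) x) (at x)"
proof -
  consider "x > 0" | "x < 0" | "x = 0" by linarith
  then show ?thesis
  proof cases
    case 1
    have "((\<lambda>x. poly p (1 / x) * exp (- (1 / x))) has_real_derivative
        flat_exp ([:0, 0, 1:] * (p - pderiv p)) x) (at x)"
      using 1 unfolding flat_exp_def
      by (auto intro!: derivative_eq_intros DERIV_chain2[OF poly_DERIV] simp: field_simps power2_eq_square)
    moreover have "\<forall>\<^sub>F y in nhds x. y \<in> {0<..}" using 1 by (intro eventually_nhds_in_open) auto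
    then have "\<forall>\<^sub>F y in nhds x. flat_exp p y = poly p (1 / y) * exp (- (1 / y))"
      by (rule eventually_mono) (auto simp: flat_exp_def)
    ultimately show ?thesis by (subst DERIV_cong_ev[OF refl _ refl]) auto
  next
    case 2
    have "\<forall>\<^sub>F y in nhds x. y \<in> {..<0}" using 2 by (intro eventually_nhds_in_open) auto
    then have "\<forall>\<^sub>F y in nhds x. flat_exp p y = 0"
      by (rule eventually_mono) (auto simp: flat_exp_def)
    then have "(flat_exp p has_real_derivative 0) (at x)"
      by (subst DERIV_cong_ev[OF refl _ refl, where g = "\<lambda>_. 0"]) auto
    then show ?thesis using 2 by (simp add: flat_exp_def)
  next
    case 3
    have L: "((\<lambda>h. (flat_exp p (0 + h) - flat_exp p 0) / h) \<longlongrightarrow> 0) (at_left 0)"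
      by (rule tendsto_eventually) (auto simp: flat_exp_def eventually_at_left_field intro: exI[of _ "-1"])
    \<comment> \<open>With \<open>t = 1 / h\<close> the right-hand difference quotient at 0 is
      \<open>t p(t) exp(-t)\<close>, which is why \<open>p\<close> is multiplied by the
      variable.\<close>
    have "((\<lambda>h::real. poly (pCons 0 p) (inverse h) * exp (- inverse h)) \<longlongrightarrow> 0) (at_right 0)"
      by (rule filterlim_compose[OF poly_exp_tendsto_0 filterlim_inverse_at_top_right])
    moreover have "\<forall>\<^sub>F h::real in at_right 0. h > 0" by (simp add: eventually_at_right_less)
    then have "\<forall>\<^sub>F h in at_right 0. poly (pCons 0 p) (inverse h) * exp (- inverse h) =
         (flat_exp p (0 + h) - flat_exp p 0) / h"
      by (rule eventually_mono) (auto simp: flat_exp_def field_simps)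
    ultimately have R: "((\<lambda>h. (flat_exp p (0 + h) - flat_exp p 0) / h) \<longlongrightarrow> 0) (at_right 0)"
      by (rule Lim_transform_eventually)
    have "(flat_exp p has_real_derivative 0) (at 0)"
      unfolding DERIV_def by (rule filterlim_split_at[OF L R])
    then show ?thesis using 3 by (simp add: flat_exp_def)
  qed
qed

lemma Cn_on_flat_exp:
  assumes "open V"
  shows "Cn_on n V f \<Longrightarrow> Cn_on n V (\<lambda>x. flat_exp p (f x))"
proof (induction n arbitrary: p)
  case 0
  have "continuous_on UNIV (flat_exp p)"
    using has_real_derivative_flat_exp DERIV_continuous by (blast intro: continuous_at_imp_continuous_on)
  then show ?case using 0 by (auto intro: continuous_on_compose2)
next
  case (Suc n)
  let ?p = "[:0, 0, 1:] * (p - pderiv p)"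
  have "((\<lambda>x. flat_exp p (f x)) has_derivative
      (\<lambda>v. flat_exp ?p (f x) * frechet_derivative f (at x) v)) (at x)" if "x \<in> V" for x
    using has_derivative_compose[OF Cn_on_SucE(1)[OF Suc.prems that]
        has_real_derivative_flat_exp[unfolded has_field_derivative_def]] .
  moreover have "Cn_on n V (\<lambda>x. flat_exp ?p (f x) * frechet_derivative f (at x) v)" for v
    by (intro Cn_on_mult assms Suc.IH Cn_on_SucD[OF Suc.prems] Cn_on_SucE(2)[OF Suc.prems])
  ultimately show ?case by (rule Cn_on_SucI[OF assms])
qed

text \<open>The inner term is at least \<open>1\<close> for \<open>s \<le> 0\<close> and vanishes for \<open>s \<ge> 1\<close>; composing avoids a quotient.\<close>

definition smooth_step :: "real \<Rightarrow> real" where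
  "smooth_step s = exp 1 * flat_exp 1 (1 - exp 1 * flat_exp 1 (1 - s))"

lemma smooth_step_eq_0: "s \<le> 0 \<Longrightarrow> smooth_step s = 0"
  by (simp add: smooth_step_def flat_exp_def exp_add[symmetric] field_simps)

lemma smooth_step_eq_1: "s \<ge> 1 \<Longrightarrow> smooth_step s = 1"
  by (simp add: smooth_step_def flat_exp_def exp_add[symmetric])

lemma smooth_step_bounds: "0 \<le> smooth_step s" "smooth_step s \<le> 1"
proof -
  have "exp 1 * flat_exp 1 x \<le> 1" if "x \<le> 1" for x
    using that by (simp add: flat_exp_def exp_add[symmetric] field_simps)
  moreover have "0 \<le> flat_exp 1 x" for x by (simp add: flat_exp_def)
  ultimately show "0 \<le> smooth_step s" "smooth_step s \<le> 1"
    by (simp_all add: smooth_step_def)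
qed

lemma Cn_on_smooth_step:
  assumes "open V" "Cn_on n V f"
  shows "Cn_on n V (\<lambda>x. smooth_step (f x))"
  unfolding smooth_step_def using assms
  by (intro Cn_on_mult Cn_on_flat_exp Cn_on_diff Cn_on_const) auto

section \<open>Symmetry of second derivatives\<close>

lemma second_difference_mean_value:
  fixes f fv fvw :: "'a::real_normed_vector \<Rightarrow> real"
  assumes v: "\<And>y. y \<in> U \<Longrightarrow> ((\<lambda>s. f (y + s *\<^sub>R v)) has_real_derivative fv y) (at 0)"
    and w: "\<And>y. y \<in> U \<Longrightarrow> ((\<lambda>s. fv (y + s *\<^sub>R w)) has_real_derivative fvw y) (at 0)"
    and U: "cball x (s * (norm v + norm w)) \<subseteq> U" and "s > 0"
  shows "\<exists>\<xi>\<in>cball x (s * (norm v + norm w)).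
     f (x + s *\<^sub>R v + s *\<^sub>R w) - f (x + s *\<^sub>R v) - f (x + s *\<^sub>R w) + f x = s * s * fvw \<xi>"
proof -
  have mem: "x + a *\<^sub>R v + b *\<^sub>R w \<in> cball x (s * (norm v + norm w))" if "0 \<le> a" "a \<le> s" "0 \<le> b" "b \<le> s" for a b
  proof -
    have "norm (a *\<^sub>R v + b *\<^sub>R w) \<le> a * norm v + b * norm w"
      using that norm_triangle_ineq[of "a *\<^sub>R v" "b *\<^sub>R w"] by simp
    also have "\<dots> \<le> s * norm v + s * norm w"
      using that by (intro add_mono mult_right_mono) auto
    finally show ?thesis
      using norm_minus_commute[of x "x + a *\<^sub>R v + b *\<^sub>R w"] by (simp add: dist_norm algebra_simps)
  qed
  have mem0: "x + a *\<^sub>R v \<in> cball x (s * (norm v + norm w))" if "0 \<le> a" "a \<le> s" for a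
    using mem[of a 0] that \<open>s > 0\<close> by simp
  have d1: "((\<lambda>a. f (x + a *\<^sub>R v + s *\<^sub>R w) - f (x + a *\<^sub>R v)) has_real_derivative
      fv (x + a *\<^sub>R v + s *\<^sub>R w) - fv (x + a *\<^sub>R v)) (at a)" if "0 \<le> a" "a \<le> s" for a
  proof (intro DERIV_diff)
    have "((\<lambda>a. f ((x + s *\<^sub>R w) + a *\<^sub>R v)) has_real_derivative fv (x + a *\<^sub>R v + s *\<^sub>R w)) (at a)"
    proof (rule DERIV_line_shift)
      have "x + a *\<^sub>R v + s *\<^sub>R w \<in> U" using mem[of a s] U that \<open>s > 0\<close> by auto
      from v[OF this] show "((\<lambda>t. f (x + s *\<^sub>R w + a *\<^sub>R v + t *\<^sub>R v)) has_real_derivative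
          fv (x + a *\<^sub>R v + s *\<^sub>R w)) (at 0)"
        by (simp only: add_ac)
    qed
    then show "((\<lambda>a. f (x + a *\<^sub>R v + s *\<^sub>R w)) has_real_derivative fv (x + a *\<^sub>R v + s *\<^sub>R w)) (at a)"
      by (simp only: add_ac)
    show "((\<lambda>a. f (x + a *\<^sub>R v)) has_real_derivative fv (x + a *\<^sub>R v)) (at a)"
      using v[of "x + a *\<^sub>R v"] mem0[of a] U that by - (rule DERIV_line_shift, auto)
  qed
  \<comment> \<open>The first mean value is in direction \<open>v\<close>, for the increment of
    \<open>f\<close> over \<open>s *\<^sub>R w\<close>; the second one below is in direction
    \<open>w\<close>, for \<open>fv\<close>.\<close>
  obtain a where a: "0 < a" "a < s"
    "(f (x + s *\<^sub>R v + s *\<^sub>R w) - f (x + s *\<^sub>R v)) - (f (x + 0 *\<^sub>R v + s *\<^sub>R w) - f (x + 0 *\<^sub>R v))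
      = (s - 0) * (fv (x + a *\<^sub>R v + s *\<^sub>R w) - fv (x + a *\<^sub>R v))"
    using MVT2[OF \<open>s > 0\<close> d1] by blast
  have d2: "((\<lambda>b. fv (x + a *\<^sub>R v + b *\<^sub>R w)) has_real_derivative fvw (x + a *\<^sub>R v + b *\<^sub>R w)) (at b)"
    if "0 \<le> b" "b \<le> s" for b
    using w[of "x + a *\<^sub>R v + b *\<^sub>R w"] mem[of a b] U that a by - (rule DERIV_line_shift, auto)
  obtain b where b: "0 < b" "b < s"
    "fv (x + a *\<^sub>R v + s *\<^sub>R w) - fv (x + a *\<^sub>R v + 0 *\<^sub>R w) = (s - 0) * fvw (x + a *\<^sub>R v + b *\<^sub>R w)"
    using MVT2[OF \<open>s > 0\<close> d2] by blast
  show ?thesis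
    using a b mem[of a b] by (intro bexI[of _ "x + a *\<^sub>R v + b *\<^sub>R w"]) (auto simp: algebra_simps)
qed

text \<open>The second difference is symmetric in \<open>v\<close> and \<open>w\<close>, so after
  division by \<open>s * s\<close> it is a value of either mixed derivative near \<open>x\<close>.
  Continuity then forbids that the two differ at \<open>x\<close>.\<close>

lemma mixed_derivatives_eq:
  fixes f fv fw fvw fwv :: "'a::real_normed_vector \<Rightarrow> real"
  assumes U: "open U" "x \<in> U"
    and v: "\<And>y. y \<in> U \<Longrightarrow> ((\<lambda>s. f (y + s *\<^sub>R v)) has_real_derivative fv y) (at 0)"
    and vw: "\<And>y. y \<in> U \<Longrightarrow> ((\<lambda>s. fv (y + s *\<^sub>R w)) has_real_derivative fvw y) (at 0)"
    and w: "\<And>y. y \<in> U \<Longrightarrow> ((\<lambda>s. f (y + s *\<^sub>R w)) has_real_derivative fw y) (at 0)"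
    and wv: "\<And>y. y \<in> U \<Longrightarrow> ((\<lambda>s. fw (y + s *\<^sub>R v)) has_real_derivative fwv y) (at 0)"
    and cont: "continuous_on U fvw" "continuous_on U fwv"
  shows "fvw x = fwv x"
proof (rule ccontr)
  assume "fvw x \<noteq> fwv x"
  define e where "e = \<bar>fvw x - fwv x\<bar> / 2"
  have "e > 0" using \<open>fvw x \<noteq> fwv x\<close> by (simp add: e_def)
  obtain d1 where d1: "d1 > 0" "\<And>y. y \<in> U \<Longrightarrow> dist y x < d1 \<Longrightarrow> dist (fvw y) (fvw x) < e"
    using cont(1) U \<open>e > 0\<close> unfolding continuous_on_iff by metis
  obtain d2 where d2: "d2 > 0" "\<And>y. y \<in> U \<Longrightarrow> dist y x < d2 \<Longrightarrow> dist (fwv y) (fwv x) < e"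
    using cont(2) U \<open>e > 0\<close> unfolding continuous_on_iff by metis
  obtain d3 where d3: "d3 > 0" "ball x d3 \<subseteq> U" using U openE by blast
  \<comment> \<open>The summand 1 keeps \<open>N\<close> positive when both directions are
    zero.\<close>
  define N where "N = norm v + norm w + 1"
  have N: "N > 0" "norm v + norm w < N" by (auto simp: N_def intro: add_nonneg_pos)
  define d where "d = min d1 (min d2 d3)"
  define s where "s = d / N"
  have "d > 0" using d1 d2 d3 by (simp add: d_def)
  then have "s > 0" using N by (simp add: s_def)
  moreover have "s * (norm v + norm w) < s * N" using \<open>s > 0\<close> N(2) by simp
  ultimately have s: "s > 0" "s * (norm v + norm w) < d"
    using N by (auto simp: s_def)
  have sub: "cball x (s * (norm v + norm w)) \<subseteq> ball x d" using s by auto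
  then have subU: "cball x (s * (norm v + norm w)) \<subseteq> U"
  proof -
    have "ball x d \<subseteq> ball x d3" by (rule subset_ball) (simp add: d_def)
    then show ?thesis using sub d3(2) by blast
  qed
  obtain \<xi> where \<xi>: "\<xi> \<in> cball x (s * (norm v + norm w))"
     "f (x + s *\<^sub>R v + s *\<^sub>R w) - f (x + s *\<^sub>R v) - f (x + s *\<^sub>R w) + f x = s * s * fvw \<xi>"
    using second_difference_mean_value[OF v vw subU s(1)] by blast
  have subU': "cball x (s * (norm w + norm v)) \<subseteq> U" using subU by (simp add: add.commute)
  obtain \<eta> where \<eta>: "\<eta> \<in> cball x (s * (norm w + norm v))"
     "f (x + s *\<^sub>R w + s *\<^sub>R v) - f (x + s *\<^sub>R w) - f (x + s *\<^sub>R v) + f x = s * s * fwv \<eta>"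
    using second_difference_mean_value[OF w wv subU' s(1)] by blast
  have "s * s * fvw \<xi> = s * s * fwv \<eta>" using \<xi>(2) \<eta>(2) by (simp add: algebra_simps)
  then have eq: "fvw \<xi> = fwv \<eta>" using s by simp
  have "\<xi> \<in> ball x d" "\<eta> \<in> ball x d" using \<xi>(1) \<eta>(1) sub by (auto simp: add.commute)
  moreover have "ball x d \<subseteq> U" using d3 by (auto simp: d_def)
  ultimately have "dist (fvw \<xi>) (fvw x) < e" "dist (fwv \<eta>) (fwv x) < e"
    by (intro d1 d2; auto simp: d_def dist_commute)+
  moreover have "\<bar>fvw x - fwv x\<bar> \<le> \<bar>fvw \<xi> - fvw x\<bar> + \<bar>fwv \<eta> - fwv x\<bar>"
    using eq by simp
  ultimately show False unfolding e_def dist_real_def by argo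
qed

section \<open>Homotopy invariance of the degree integral\<close>

definition partial1 :: "(real^'n \<Rightarrow> real^'n) \<Rightarrow> 'n \<Rightarrow> 'n \<Rightarrow> real^'n \<Rightarrow> real" where
  "partial1 G i j x = frechet_derivative G (at x) (axis j 1) $ i"

definition partial2 :: "(real^'n \<Rightarrow> real^'n) \<Rightarrow> 'n \<Rightarrow> 'n \<Rightarrow> 'n \<Rightarrow> real^'n \<Rightarrow> real" where
  "partial2 G i j l x = frechet_derivative (\<lambda>x. frechet_derivative G (at x) (axis j 1)) (at x) (axis l 1) $ i"

lemma jacobian_det_partial1: "jacobian_det G x = det (\<chi> i j. partial1 G i j x)"
  by (simp add: jacobian_det_def jacobian_def matrix_def partial1_def)

lemma has_real_derivative_line:
  fixes f :: "real^'n \<Rightarrow> real^'m"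
  assumes "(f has_derivative f') (at x)"
  shows "((\<lambda>s. f (x + s *\<^sub>R e) $ i) has_real_derivative f' e $ i) (at 0)"
proof -
  have "((\<lambda>s. x + s *\<^sub>R e) has_derivative (\<lambda>s. s *\<^sub>R e)) (at 0)"
    by (auto intro!: derivative_eq_intros)
  moreover have "(f has_derivative f') (at (x + 0 *\<^sub>R e))" using assms by simp
  ultimately have "((\<lambda>s. f (x + s *\<^sub>R e)) has_derivative (\<lambda>s. f' (s *\<^sub>R e))) (at 0)"
    by (rule has_derivative_compose)
  then have "((\<lambda>s. f (x + s *\<^sub>R e) $ i) has_derivative (\<lambda>s. f' (s *\<^sub>R e) $ i)) (at 0)"
    by (rule bounded_linear.has_derivative[OF bounded_linear_vec_nth])
  moreover have "(\<lambda>s. f' (s *\<^sub>R e) $ i) = (*) (f' e $ i)"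
    using linear_cmul[OF has_derivative_linear[OF assms]] by (auto simp: fun_eq_iff)
  ultimately show ?thesis by (simp add: has_field_derivative_def)
qed

lemma partial1_has_derivative:
  assumes "Cn_on 2 U G" "x \<in> U"
  shows "((\<lambda>s. G (x + s *\<^sub>R axis j 1) $ i) has_real_derivative partial1 G i j x) (at 0)"
  using has_real_derivative_line[OF Cn_on_SucE(1)[of 1 U G x]] assms
  by (simp add: partial1_def eval_nat_numeral)

lemma partial2_has_derivative:
  assumes "Cn_on 2 U G" "x \<in> U"
  shows "((\<lambda>s. partial1 G i j (x + s *\<^sub>R axis l 1)) has_real_derivative partial2 G i j l x) (at 0)"
proof -
  have "Cn_on (Suc 0) U (\<lambda>x. frechet_derivative G (at x) (axis j 1))"
    using assms(1) by (simp add: eval_nat_numeral)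
  from has_real_derivative_line[OF Cn_on_SucE(1)[OF this assms(2)]] show ?thesis
    by (simp add: partial1_def partial2_def)
qed

lemma continuous_on_Cn:
  assumes "Cn_on 2 U G"
  shows "continuous_on U G" "continuous_on U (partial1 G i j)" "continuous_on U (partial2 G i j l)"
proof -
  have G: "Cn_on (Suc (Suc 0)) U G" using assms by (simp add: eval_nat_numeral)
  then show "continuous_on U G" using Cn_on_SucD[OF Cn_on_SucD[OF G]] by simp
  have G1: "Cn_on (Suc 0) U (\<lambda>x. frechet_derivative G (at x) (axis j 1))" using G by simp
  then show "continuous_on U (partial1 G i j)" "continuous_on U (partial2 G i j l)"
    using Cn_on_SucD[OF G1] unfolding partial1_def[abs_def] partial2_def[abs_def]
    by (auto intro!: continuous_intros)
qed

lemma partial2_commute: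
  assumes "open U" "Cn_on 2 U G" "x \<in> U"
  shows "partial2 G i j l x = partial2 G i l j x"
  using assms
  by (intro mixed_derivatives_eq[OF assms(1,3), where f = "\<lambda>x. G x $ i" and v = "axis j 1" and w = "axis l 1"
        and fv = "partial1 G i j" and fw = "partial1 G i l"])
    (auto intro: partial1_has_derivative partial2_has_derivative continuous_on_Cn)

lemma continuous_on_det:
  fixes M :: "'a::topological_space \<Rightarrow> real^'n^'n"
  assumes "continuous_on S M"
  shows "continuous_on S (\<lambda>x. det (M x))"
  unfolding det_def using assms by (intro continuous_intros) auto

lemma continuous_on_det_row:
  fixes A :: "'a::topological_space \<Rightarrow> real^'n^'n"
  assumes "continuous_on S v" "continuous_on S A"
  shows "continuous_on S (\<lambda>x. det (\<chi> r. if r = i then v x else A x $ r))"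
proof (intro continuous_on_det continuous_on_vec_lambda)
  show "continuous_on S (\<lambda>x. if r = i then v x else A x $ r)" for r
    using assms by (cases "r = i") (auto intro!: continuous_intros)
qed

text \<open>\<open>\<omega>'\<close> is the \<open>t\<close>-derivative of
  \<open>\<phi>(H) det A\<close>, and component \<open>j\<close> of \<open>X\<close> pairs
  \<open>V\<close> with column \<open>j\<close> of the cofactor matrix. In the divergence of
  \<open>X\<close>, derivatives of \<open>\<phi>(H)\<close> recombine with cofactors to the first
  term of \<open>\<omega>'\<close>, derivatives of \<open>V\<close> give determinants with one row
  replaced, and derivatives of cofactors cancel by symmetry of the Hessian.\<close>

lemma degree_density_divergence:
  fixes G V :: "real^'n \<Rightarrow> real^'n" and \<phi> :: "real^'n \<Rightarrow> real" and g :: "real^'n \<Rightarrow> real^'n"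
  assumes U: "open U" and G: "Cn_on 2 U G" and V: "Cn_on 2 U V"
    and phi: "\<And>y. (\<phi> has_derivative (\<lambda>h. g y \<bullet> h)) (at y)" and g: "continuous_on UNIV g"
  defines "H \<equiv> \<lambda>t x. G x + t *\<^sub>R V x"
    and "A \<equiv> \<lambda>t x. \<chi> i j. partial1 G i j x + t * partial1 V i j x"
  defines "X \<equiv> \<lambda>t j x. \<phi> (H t x) * (\<Sum>i\<in>UNIV. V x $ i * det (\<chi> r. if r = i then axis j 1 else A t x $ r))"
    and "\<omega>' \<equiv> \<lambda>t x. (g (H t x) \<bullet> V x) * det (A t x) +
        \<phi> (H t x) * (\<Sum>i\<in>UNIV. det (\<chi> r. if r = i then (\<chi> j. partial1 V i j x) else A t x $ r))"
  obtains X' where "\<And>j. continuous_on U (X' j)"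
    "\<And>j x. x \<in> U \<Longrightarrow> ((\<lambda>s. X t j (x + s *\<^sub>R axis j 1)) has_real_derivative X' j x) (at 0)"
    "\<And>x. x \<in> U \<Longrightarrow> (\<Sum>j\<in>UNIV. X' j x) = \<omega>' t x"
proof -
  define C where "C = (\<lambda>x i j. det (\<chi> r. if r = i then axis j 1 else A t x $ r))"
  define b where "b = (\<lambda>l m j x. partial2 G l m j x + t * partial2 V l m j x)"
  \<comment> \<open>Derivative of the cofactor \<open>C x i j\<close> in direction \<open>j\<close>,
    one row at a time; row \<open>i\<close> is the constant \<open>axis j 1\<close>, hence the zero
    row for \<open>l = i\<close>.\<close>
  define dC where "dC = (\<lambda>x i j. \<Sum>l\<in>UNIV. det (\<chi> r. if r = l then (if l = i then 0 else \<chi> m. b l m j x)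
     else (\<chi> r. if r = i then axis j 1 else A t x $ r) $ r))"
  define c where "c = (\<lambda>x j. g (H t x) \<bullet> (\<chi> i. A t x $ i $ j))"
  define X' where "X' = (\<lambda>j x. c x j * (\<Sum>i\<in>UNIV. V x $ i * C x i j) +
     \<phi> (H t x) * (\<Sum>i\<in>UNIV. partial1 V i j x * C x i j + V x $ i * dC x i j))"
  note cont = continuous_on_Cn[OF G] continuous_on_Cn[OF V]
  have cH: "continuous_on U (H t)" unfolding H_def by (intro continuous_intros cont)
  have cA: "continuous_on U (A t)" unfolding A_def by (intro continuous_intros cont)
  have cphi: "continuous_on U (\<lambda>x. \<phi> (H t x))"
    by (rule continuous_on_compose2[OF _ cH, of UNIV])
      (auto intro!: has_derivative_continuous_on[where f' = "\<lambda>y h. g y \<bullet> h"] phi)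
  have cg: "continuous_on U (\<lambda>x. g (H t x))"
    by (rule continuous_on_compose2[OF g cH]) auto
  have cC: "continuous_on U (\<lambda>x. C x i j)" for i j
    unfolding C_def by (intro continuous_on_det_row continuous_intros cA)
  have cdC: "continuous_on U (\<lambda>x. dC x i j)" for i j
    unfolding dC_def
  proof (intro continuous_on_sum continuous_on_det_row)
    show "continuous_on U (\<lambda>x. if l = i then 0 else \<chi> m. b l m j x)" for l
      unfolding b_def by (cases "l = i") (auto intro!: continuous_intros cont)
    show "continuous_on U (\<lambda>x. \<chi> r. if r = i then axis j 1 else A t x $ r)"
    proof (intro continuous_on_vec_lambda)
      show "continuous_on U (\<lambda>x. if r = i then axis j 1 else A t x $ r)" for r
        by (cases "r = i") (auto intro!: continuous_intros cA)
    qed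
  qed
  have cX': "continuous_on U (X' j)" for j
    unfolding X'_def c_def by (intro continuous_intros cphi cg cC cdC cont cA)
  have dH: "((\<lambda>s. H t (x + s *\<^sub>R axis j 1)) has_derivative (\<lambda>s. s *\<^sub>R (\<chi> i. A t x $ i $ j))) (at 0)"
    if x: "x \<in> U" for x j
  proof -
    have "((\<lambda>s. H t (x + s *\<^sub>R axis j 1) $ i) has_real_derivative A t x $ i $ j) (at 0)" for i
      unfolding H_def A_def using partial1_has_derivative[OF G x] partial1_has_derivative[OF V x]
      by (auto intro!: derivative_eq_intros)
    then show ?thesis
      by (subst has_derivative_componentwise_within)
        (auto simp: Basis_vec_def inner_axis has_field_derivative_def mult_commute_abs)
  qed
  have dphi: "((\<lambda>s. \<phi> (H t (x + s *\<^sub>R axis j 1))) has_real_derivative c x j) (at 0)" if x: "x \<in> U" for x j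
    using has_derivative_compose[OF dH[OF x, of j] phi]
    by (simp add: has_field_derivative_def c_def mult_commute_abs)
  have dA: "((\<lambda>s. A t (x + s *\<^sub>R axis j 1) $ l $ m) has_real_derivative b l m j x) (at 0)" if x: "x \<in> U" for x j l m
    unfolding A_def b_def using partial2_has_derivative[OF G x] partial2_has_derivative[OF V x]
    by (auto intro!: derivative_eq_intros)
  have dCd: "((\<lambda>s. C (x + s *\<^sub>R axis j 1) i j) has_real_derivative dC x i j) (at 0)" if x: "x \<in> U" for x i j
  proof -
    have "((\<lambda>s. (\<chi> r. if r = i then axis j 1 else A t (x + s *\<^sub>R axis j 1) $ r) $ r $ m) has_real_derivative
       (\<chi> r. if r = i then 0 else \<chi> m. b r m j x) $ r $ m) (at 0)" for r m
      using dA[OF x] by (cases "r = i") auto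
    from has_real_derivative_det[OF this] show ?thesis
      unfolding C_def dC_def by (simp cong: if_cong)
  qed
  have dX: "((\<lambda>s. X t j (x + s *\<^sub>R axis j 1)) has_real_derivative X' j x) (at 0)" if x: "x \<in> U" for x j
  proof -
    have V': "((\<lambda>s. V (x + s *\<^sub>R axis j 1) $ i) has_real_derivative partial1 V i j x) (at 0)" for i
      by (rule partial1_has_derivative[OF V x])
    have S: "((\<lambda>s. \<Sum>i\<in>UNIV. V (x + s *\<^sub>R axis j 1) $ i * C (x + s *\<^sub>R axis j 1) i j) has_real_derivative
       (\<Sum>i\<in>UNIV. partial1 V i j x * C x i j + V x $ i * dC x i j)) (at 0)"
      by (intro DERIV_sum) (use DERIV_mult[OF V' dCd[OF x]] in \<open>simp add: algebra_simps\<close>)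
    have Xeq: "X t j y = \<phi> (H t y) * (\<Sum>i\<in>UNIV. V y $ i * C y i j)" for y
      by (simp add: X_def C_def)
    show ?thesis
      unfolding Xeq X'_def using DERIV_mult[OF dphi[OF x, of j] S] by (simp add: mult.commute add.commute)
  qed
  have sum: "(\<Sum>j\<in>UNIV. X' j x) = \<omega>' t x" if x: "x \<in> U" for x
  proof -
    have dC0: "(\<Sum>j\<in>UNIV. dC x i j) = 0" for i
    proof -
      have "(\<Sum>j\<in>UNIV. dC x i j) = (\<Sum>l\<in>UNIV. \<Sum>j\<in>UNIV. det (\<chi> r. if r = l then (if l = i then 0 else \<chi> m. b l m j x)
          else (\<chi> r. if r = i then axis j 1 else A t x $ r) $ r))"
        unfolding dC_def by (rule sum.swap)
      also have "\<dots> = (\<Sum>l\<in>(UNIV :: 'n set). 0)"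
      proof (rule sum.cong[OF refl])
        fix l
        show "(\<Sum>j\<in>UNIV. det (\<chi> r. if r = l then (if l = i then 0 else \<chi> m. b l m j x)
          else (\<chi> r. if r = i then axis j 1 else A t x $ r) $ r)) = 0"
        proof (cases "l = i")
          case True
          then show ?thesis by (intro sum.neutral ballI det_zero_row(1)[of l]) (simp add: row_def vec_eq_iff)
        next
          case False
          have "b l m j x = b l j m x" for j m
            unfolding b_def using partial2_commute[OF U G x] partial2_commute[OF U V x] by metis
          then have "(\<Sum>j\<in>UNIV. det (\<chi> r. if r = l then (\<chi> m. b l m j x) else if r = i then axis j 1 else A t x $ r)) = 0"
            using False by (intro sum_det_symmetric_eq_0) auto
          then show ?thesis using False by (simp cong: if_cong)
        qed
      qed
      finally show ?thesis by simp
    qed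
    have first: "(\<Sum>j\<in>UNIV. c x j * C x i j) = g (H t x) $ i * det (A t x)" for i
    proof -
      \<comment> \<open>By the chain rule the gradient of \<open>\<phi>(H)\<close> is a combination
        of the rows of \<open>A\<close>, so inserting it as row \<open>i\<close> leaves only its
        coefficient at \<open>i\<close>.\<close>
      have ceq: "(\<chi> j. c x j) = (\<Sum>l\<in>UNIV. g (H t x) $ l *s A t x $ l)"
        by (simp add: vec_eq_iff c_def inner_vec_def)
      have "(\<Sum>j\<in>UNIV. c x j * C x i j) = det (\<chi> r. if r = i then (\<chi> j. c x j) else A t x $ r)"
        unfolding det_row_expand[of i "\<chi> j. c x j"] by (simp add: C_def)
      also have "\<dots> = g (H t x) $ i * det (A t x)"
        unfolding ceq by (rule det_row_combination)
      finally show ?thesis .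
    qed
    have second: "(\<Sum>j\<in>UNIV. partial1 V i j x * C x i j) =
        det (\<chi> r. if r = i then (\<chi> j. partial1 V i j x) else A t x $ r)" for i
      using det_row_expand[of i "\<chi> j. partial1 V i j x" "($) (A t x)"] by (simp add: C_def)
    have "(\<Sum>j\<in>UNIV. X' j x) = (\<Sum>j\<in>UNIV. \<Sum>i\<in>UNIV. V x $ i * (c x j * C x i j)) +
       \<phi> (H t x) * ((\<Sum>j\<in>UNIV. \<Sum>i\<in>UNIV. partial1 V i j x * C x i j) + (\<Sum>j\<in>UNIV. \<Sum>i\<in>UNIV. V x $ i * dC x i j))"
      unfolding X'_def by (simp add: sum.distrib sum_distrib_left algebra_simps)
    also have "(\<Sum>j\<in>UNIV. \<Sum>i\<in>UNIV. V x $ i * (c x j * C x i j)) = (\<Sum>i\<in>UNIV. V x $ i * (\<Sum>j\<in>UNIV. c x j * C x i j))"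
      by (subst sum.swap) (simp add: sum_distrib_left)
    also have "\<dots> = (g (H t x) \<bullet> V x) * det (A t x)"
      by (simp add: first inner_vec_def sum_distrib_right sum_distrib_left mult_ac)
    also have "(\<Sum>j\<in>UNIV. \<Sum>i\<in>UNIV. partial1 V i j x * C x i j) =
        (\<Sum>i\<in>UNIV. det (\<chi> r. if r = i then (\<chi> j. partial1 V i j x) else A t x $ r))"
      by (subst sum.swap) (simp add: second)
    also have "(\<Sum>j\<in>UNIV. \<Sum>i\<in>UNIV. V x $ i * dC x i j) = (\<Sum>i\<in>UNIV. V x $ i * (\<Sum>j\<in>UNIV. dC x i j))"
      by (subst sum.swap) (simp add: sum_distrib_left)
    also have "\<dots> = 0" by (simp add: dC0)
    finally show ?thesis by (simp add: \<omega>'_def)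
  qed
  show ?thesis using that cX' dX sum by blast
qed

lemma partial1_add_scale:
  assumes "open U" "Cn_on 2 U G" "Cn_on 2 U V" "x \<in> U"
  shows "partial1 (\<lambda>x. G x + t *\<^sub>R V x) i j x = partial1 G i j x + t * partial1 V i j x"
proof -
  have C: "Cn_on (Suc 1) U G" "Cn_on (Suc 1) U V" using assms by (simp_all add: eval_nat_numeral)
  have "((\<lambda>x. G x + t *\<^sub>R V x) has_derivative
     (\<lambda>h. frechet_derivative G (at x) h + t *\<^sub>R frechet_derivative V (at x) h)) (at x)"
    using assms(4) by (intro derivative_intros Cn_on_SucE(1)[OF C(1)] Cn_on_SucE(1)[OF C(2)])
  then show ?thesis unfolding partial1_def by (simp flip: frechet_derivative_at)
qed

text \<open>\<open>K\<close> does not depend on \<open>t\<close>: the integrand and its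
  \<open>t\<close>-derivative vanish on \<open>U - K\<close> at all times, so one differentiates
  under the integral over a fixed box and no boundary terms appear. The gradient \<open>g\<close> is
  asked to vanish there as well because it occurs in \<open>\<omega>'\<close>.\<close>

lemma degree_integral_homotopy:
  fixes G V :: "real^'n \<Rightarrow> real^'n" and \<phi> :: "real^'n \<Rightarrow> real" and g :: "real^'n \<Rightarrow> real^'n"
  assumes U: "open U" and G: "Cn_on 2 U G" and V: "Cn_on 2 U V"
    and phi: "\<And>y. (\<phi> has_derivative (\<lambda>h. g y \<bullet> h)) (at y)" and g: "continuous_on UNIV g"
    and K: "compact K" "K \<subseteq> U"
    and zero: "\<And>x t. x \<in> U - K \<Longrightarrow> t \<in> {0..1} \<Longrightarrow> \<phi> (G x + t *\<^sub>R V x) = 0 \<and> g (G x + t *\<^sub>R V x) = 0"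
  shows "integral U (\<lambda>x. \<phi> (G x) * jacobian_det G x) =
         integral U (\<lambda>x. \<phi> (G x + V x) * jacobian_det (\<lambda>x. G x + V x) x)"
proof -
  define H where "H = (\<lambda>t x. G x + t *\<^sub>R V x)"
  define A where "A = (\<lambda>t x. \<chi> i j. partial1 G i j x + t * partial1 V i j x)"
  define \<omega> where "\<omega> = (\<lambda>t x. \<phi> (H t x) * det (A t x))"
  define \<omega>' where "\<omega>' = (\<lambda>t x. (g (H t x) \<bullet> V x) * det (A t x) +
        \<phi> (H t x) * (\<Sum>i\<in>UNIV. det (\<chi> r. if r = i then (\<chi> j. partial1 V i j x) else A t x $ r)))"
  have z: "\<omega> t x = 0" "\<omega>' t x = 0" if "x \<in> U - K" "t \<in> {0..1}" for x t
    using zero[OF that] by (auto simp: \<omega>_def \<omega>'_def H_def)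
  have int0: "integral U (\<omega>' t) = 0" if t: "t \<in> {0..1}" for t
  proof -
    obtain X' where X': "\<And>j. continuous_on U (X' j)"
      "\<And>j x. x \<in> U \<Longrightarrow> ((\<lambda>s. (\<lambda>t j x. \<phi> (G x + t *\<^sub>R V x) * (\<Sum>i\<in>UNIV. V x $ i * det (\<chi> r. if r = i then axis j 1 else
         (\<chi> i j. partial1 G i j x + t * partial1 V i j x) $ r))) t j (x + s *\<^sub>R axis j 1)) has_real_derivative X' j x) (at 0)"
      "\<And>x. x \<in> U \<Longrightarrow> (\<Sum>j\<in>UNIV. X' j x) = \<omega>' t x"
      using degree_density_divergence[OF U G V phi g, of t] unfolding \<omega>'_def H_def A_def by blast
    define X where "X = (\<lambda>j x. \<phi> (H t x) * (\<Sum>i\<in>UNIV. V x $ i * det (\<chi> r. if r = i then axis j 1 else A t x $ r)))"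
    have derX: "((\<lambda>s. X j (x + s *\<^sub>R axis j 1)) has_real_derivative X' j x) (at 0)" if "x \<in> U" for j x
      using X'(2)[OF that, of j] unfolding X_def H_def A_def .
    have cX: "continuous_on U (X j)" for j
    proof -
      have cH: "continuous_on U (H t)"
        unfolding H_def by (intro continuous_intros continuous_on_Cn[OF G] continuous_on_Cn[OF V])
      have "continuous_on UNIV \<phi>" by (auto intro!: has_derivative_continuous_on[where f' = "\<lambda>y h. g y \<bullet> h"] phi)
      from continuous_on_compose2[OF this cH] show ?thesis
        unfolding X_def A_def
        by (intro continuous_intros continuous_on_det_row continuous_on_Cn[OF G] continuous_on_Cn[OF V]) auto
    qed
    have X0: "X j x = 0" if "x \<in> U - K" for j x using zero[OF that t] by (simp add: X_def H_def)
    note * = integral_directional_derivative_eq_0[OF U K cX X0 X'(1) derX]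
    have "integral U (\<omega>' t) = integral U (\<lambda>x. \<Sum>j\<in>UNIV. X' j x)"
      by (intro integral_cong) (simp add: X'(3))
    also have "\<dots> = (\<Sum>j\<in>UNIV. integral U (X' j))"
      by (intro integral_sum integrable_extend_zero[OF U K X'(1) *(2)]) auto
    also have "\<dots> = 0" using *(1) by simp
    finally show ?thesis .
  qed
  have contA: "continuous_on ({0..1} \<times> U) (\<lambda>z. A (fst z) (snd z))"
    unfolding A_def
    by (intro continuous_intros continuous_on_compose2[OF continuous_on_Cn(2)[OF G]]
       continuous_on_compose2[OF continuous_on_Cn(2)[OF V]]) auto
  have contV: "continuous_on ({0..1} \<times> U) (\<lambda>z. V (snd z))"
    by (intro continuous_on_compose2[OF continuous_on_Cn(1)[OF V]] continuous_intros) auto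
  have contW: "continuous_on ({0..1} \<times> U) (\<lambda>z. partial1 V i j (snd z))" for i j
    by (intro continuous_on_compose2[OF continuous_on_Cn(2)[OF V]] continuous_intros) auto
  have contH: "continuous_on ({0..1} \<times> U) (\<lambda>z. H (fst z) (snd z))"
    unfolding H_def
    by (intro continuous_intros continuous_on_compose2[OF continuous_on_Cn(1)[OF G]] contV) auto
  have "continuous_on UNIV \<phi>" by (auto intro!: has_derivative_continuous_on[where f' = "\<lambda>y h. g y \<bullet> h"] phi)
  from continuous_on_compose2[OF this contH]
  have contphi: "continuous_on ({0..1} \<times> U) (\<lambda>z. \<phi> (H (fst z) (snd z)))" by simp
  have contg: "continuous_on ({0..1} \<times> U) (\<lambda>z. g (H (fst z) (snd z)))"
    using continuous_on_compose2[OF g contH] by simp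
  have cont\<omega>': "continuous_on ({0..1} \<times> U) (\<lambda>z. \<omega>' (fst z) (snd z))"
    unfolding \<omega>'_def
    by (intro continuous_intros contphi contg contV contA contW continuous_on_det continuous_on_det_row)
  have cont\<omega>: "continuous_on U (\<omega> t)" if "t \<in> {0..1}" for t
  proof -
    have "continuous_on ({0..1} \<times> U) (\<lambda>z. \<omega> (fst z) (snd z))"
      unfolding \<omega>_def by (intro continuous_intros contphi contA continuous_on_det)
    moreover have "continuous_on U (\<lambda>x. (t, x))" by (intro continuous_intros)
    ultimately have "continuous_on U (\<lambda>x. \<omega> (fst (t, x)) (snd (t, x)))"
      by (rule continuous_on_compose2) (use that in auto)
    then show ?thesis by simp
  qed
  have d\<omega>: "((\<lambda>t. \<omega> t x) has_real_derivative \<omega>' t x) (at t within T)" for t x T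
  proof -
    have "((\<lambda>t. H t x) has_derivative (\<lambda>s. s *\<^sub>R V x)) (at t within T)"
      unfolding H_def by (auto intro!: derivative_eq_intros)
    from has_derivative_compose[OF this phi]
    have 1: "((\<lambda>t. \<phi> (H t x)) has_real_derivative g (H t x) \<bullet> V x) (at t within T)"
      by (simp add: has_field_derivative_def mult_commute_abs)
    have "((\<lambda>t. A t x $ i $ j) has_real_derivative (\<chi> i j. partial1 V i j x) $ i $ j) (at t within T)" for i j
      unfolding A_def by (auto intro!: derivative_eq_intros)
    from has_real_derivative_det[OF this] DERIV_mult[OF 1] show ?thesis
      unfolding \<omega>_def \<omega>'_def by (fastforce simp: algebra_simps cong: if_cong)
  qed
  obtain a b where ab: "K \<subseteq> cbox a b"
    using bounded_subset_cbox_symmetric compact_imp_bounded[OF K(1)] by metis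
  let ?F = "\<lambda>t x. if x \<in> U then \<omega> t x else 0" and ?F' = "\<lambda>t x. if x \<in> U then \<omega>' t x else 0"
  \<comment> \<open>Extension by zero stays jointly continuous: \<open>{0..1} \<times> UNIV\<close>
    is covered by the relatively open sets over \<open>U\<close> and over
    \<open>- K\<close>.\<close>
  have "continuous_on ({0..1} \<times> UNIV) (\<lambda>z. ?F' (fst z) (snd z))"
  proof -
    let ?f = "\<lambda>z. ?F' (fst z) (snd z)"
    have 1: "openin (top_of_set ({0..1} \<times> UNIV)) ({0..1::real} \<times> - K)"
      by (intro openin_Times) (use K in \<open>auto simp: compact_imp_closed open_Compl open_openin[symmetric]\<close>)
    have 2: "openin (top_of_set ({0..1} \<times> UNIV)) ({0..1::real} \<times> U)"
      by (intro openin_Times) (use U in \<open>auto simp: open_openin[symmetric]\<close>)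
    have "continuous_on ({0..1} \<times> U) ?f"
      by (rule continuous_on_eq[OF cont\<omega>']) auto
    moreover have "continuous_on ({0..1} \<times> - K) ?f"
      using z by (intro continuous_on_eq[OF continuous_on_const[of _ 0]]) auto
    moreover have "{0..1} \<times> UNIV = {0..1} \<times> U \<union> {0..1::real} \<times> - K" using K by auto
    ultimately show ?thesis
      using continuous_on_Un_local_open[of "{0..1} \<times> U" "{0..1} \<times> - K" ?f] 1 2 by metis
  qed
  then have contF': "continuous_on ({0..1} \<times> cbox a b) (\<lambda>(t, x). ?F' t x)"
    by (auto simp: split_beta intro: continuous_on_subset)
  have intF: "integral (cbox a b) (?F t) = integral U (\<omega> t)" "integral (cbox a b) (?F' t) = integral U (\<omega>' t)"
    if "t \<in> {0..1}" for t
    using z that by (auto intro!: integral_extend_zero_cbox[OF ab])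
  have "((\<lambda>t. integral (cbox a b) (?F t)) has_real_derivative 0) (at t within {0..1})" if t: "t \<in> {0..1}" for t
  proof -
    have "((\<lambda>t. integral (cbox a b) (?F t)) has_real_derivative integral (cbox a b) (?F' t)) (at t within {0..1})"
    proof (rule leibniz_rule_field_derivative[OF _ _ contF' t])
      show "((\<lambda>t. ?F t x) has_real_derivative ?F' t x) (at t within {0..1})" for t x
        using d\<omega> by auto
      show "?F t integrable_on cbox a b" if "t \<in> {0..1}" for t
        using continuous_on_extend_zero[OF U K cont\<omega>[OF that] z(1)] that
        by (blast intro: integrable_continuous continuous_on_subset)
    qed auto
    then show ?thesis using int0[OF t] intF(2)[OF t] by simp
  qed
  then obtain k where "\<And>t. t \<in> {0..1} \<Longrightarrow> integral (cbox a b) (?F t) = k"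
    using has_field_derivative_zero_constant[of "{0..1::real}" "\<lambda>t. integral (cbox a b) (?F t)"] by auto
  then have eq: "integral U (\<omega> 0) = integral U (\<omega> 1)" using intF(1)[of 0] intF(1)[of 1] by simp
  have "integral U (\<omega> 0) = integral U (\<lambda>x. \<phi> (G x) * jacobian_det G x)"
    by (simp add: \<omega>_def H_def A_def jacobian_det_partial1)
  moreover have "integral U (\<omega> 1) = integral U (\<lambda>x. \<phi> (G x + V x) * jacobian_det (\<lambda>x. G x + V x) x)"
    using partial1_add_scale[OF U G V, of _ 1]
    by (intro integral_cong) (simp add: \<omega>_def H_def A_def jacobian_det_partial1)
  ultimately show ?thesis using eq by simp
qed

text \<open>Squaring the positive part gives a \<open>C^1\<close> function with an explicit
  gradient, which is all that the divergence argument asks of it; dependence on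
  \<open>y \<bullet> y\<close> alone makes it invariant under isometries.\<close>

definition bump :: "real \<Rightarrow> real^'n \<Rightarrow> real" where
  "bump \<rho> y = (max 0 (\<rho>\<^sup>2 - y \<bullet> y))\<^sup>2"

definition bump_gradient :: "real \<Rightarrow> real^'n \<Rightarrow> real^'n" where
  "bump_gradient \<rho> y = (- 4 * max 0 (\<rho>\<^sup>2 - y \<bullet> y)) *\<^sub>R y"

lemma has_real_derivative_max_0_power2:
  "((\<lambda>s::real. (max 0 s)\<^sup>2) has_real_derivative 2 * max 0 s) (at s)"
proof -
  consider "s > 0" | "s < 0" | "s = 0" by linarith
  then show ?thesis
  proof cases
    case 1
    have "\<forall>\<^sub>F y in nhds s. y \<in> {0<..}" using 1 by (intro eventually_nhds_in_open) auto
    then have "\<forall>\<^sub>F y in nhds s. (max 0 y)\<^sup>2 = y\<^sup>2" by (rule eventually_mono) auto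
    then show ?thesis using 1 by (subst DERIV_cong_ev[OF refl _ refl]) (auto intro!: derivative_eq_intros)
  next
    case 2
    have "\<forall>\<^sub>F y in nhds s. y \<in> {..<0}" using 2 by (intro eventually_nhds_in_open) auto
    then have "\<forall>\<^sub>F y in nhds s. (max 0 y)\<^sup>2 = 0" by (rule eventually_mono) auto
    then show ?thesis using 2 by (subst DERIV_cong_ev[OF refl _ refl, where g = "\<lambda>_. 0"]) (auto intro!: derivative_eq_intros)
  next
    case 3
    have "((\<lambda>h::real. max 0 h * (max 0 h / h)) \<longlongrightarrow> 0) (at 0)"
    proof (rule tendsto_0_le[where K = 1])
      show "((\<lambda>h::real. h) \<longlongrightarrow> 0) (at 0)" by (rule tendsto_ident_at)
      show "\<forall>\<^sub>F h::real in at 0. norm (max 0 h * (max 0 h / h)) \<le> norm h * 1"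
        by (intro always_eventually) (auto simp: max_def)
    qed
    then show ?thesis using 3 by (simp add: DERIV_def power2_eq_square)
  qed
qed

lemma bump_has_derivative: "(bump \<rho> has_derivative (\<lambda>h. bump_gradient \<rho> y \<bullet> h)) (at y)"
proof -
  have "((\<lambda>y. \<rho>\<^sup>2 - y \<bullet> y) has_derivative (\<lambda>h. - 2 * (y \<bullet> h))) (at y)"
    by (auto intro!: derivative_eq_intros simp: inner_commute)
  from has_derivative_compose[OF this has_real_derivative_max_0_power2[unfolded has_field_derivative_def]]
  show ?thesis by (simp add: bump_def[abs_def] bump_gradient_def mult_ac)
qed

lemma continuous_on_bump: "continuous_on S (bump \<rho>)"
  unfolding bump_def by (intro continuous_intros)

lemma continuous_on_bump_gradient: "continuous_on S (bump_gradient \<rho>)"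
  unfolding bump_gradient_def by (intro continuous_intros)

lemma bump_eq_0:
  assumes "0 \<le> \<rho>" "\<rho> \<le> norm y"
  shows "bump \<rho> y = 0" "bump_gradient \<rho> y = 0"
proof -
  have "\<rho>\<^sup>2 \<le> y \<bullet> y" using assms by (simp add: power2_norm_eq_inner[symmetric])
  then show "bump \<rho> y = 0" "bump_gradient \<rho> y = 0" by (auto simp: bump_def bump_gradient_def)
qed

lemma bump_cong_norm: "norm x = norm y \<Longrightarrow> bump \<rho> x = bump \<rho> y"
  by (simp add: bump_def power2_norm_eq_inner[symmetric])

lemma integral_bump_pos:
  assumes "\<rho> > 0"
  shows "integral UNIV (bump \<rho> :: real^'n \<Rightarrow> real) > 0"
proof -
  let ?b = "\<rho> *\<^sub>R (One :: real^'n)"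
  have sub: "cball 0 \<rho> \<subseteq> cbox (- ?b) ?b"
  proof
    fix x :: "real^'n" assume "x \<in> cball 0 \<rho>"
    then have "\<bar>x \<bullet> i\<bar> \<le> \<rho>" if "i \<in> Basis" for i
      using norm_bound_Basis_le[OF that] by simp
    then show "x \<in> cbox (- ?b) ?b"
      by (auto simp: mem_box abs_le_iff) (metis minus_le_iff)
  qed
  have z: "bump \<rho> x = 0" if "\<rho> < norm x" for x :: "real^'n"
    using bump_eq_0(1)[of \<rho> x] assms that by simp
  have eq: "integral (cbox (- ?b) ?b) (bump \<rho>) = integral UNIV (bump \<rho> :: real^'n \<Rightarrow> real)"
    using integral_extend_zero_cbox[OF sub, of UNIV "bump \<rho>"] z by (simp add: not_le)
  have "integral (cbox (- ?b) ?b) (bump \<rho>) \<noteq> 0"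
  proof
    assume *: "integral (cbox (- ?b) ?b) (bump \<rho>) = 0"
    have "(bump \<rho> has_integral 0) (cbox (- ?b) ?b)"
      using integrable_integral[OF integrable_continuous[OF continuous_on_bump]] * by metis
    from has_integral_0_cbox_imp_0[OF continuous_on_bump _ this, of 0]
    have "bump \<rho> (0::real^'n) = 0" using assms by (auto simp: bump_def box_ne_empty mem_box)
    then show False using assms by (simp add: bump_def)
  qed
  moreover have "integral (cbox (- ?b) ?b) (bump \<rho>) \<ge> 0"
    by (intro integral_nonneg integrable_continuous continuous_on_bump) (simp add: bump_def)
  ultimately show ?thesis using eq by simp
qed

text \<open>If \<open>0\<close> is a regular value of \<open>G\<close>, then for small \<open>\<rho>\<close> this is the degree of \<open>G\<close> at \<open>0\<close>
  times the integral of the bump function.\<close>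

definition degree_integral :: "real \<Rightarrow> (real^'n) set \<Rightarrow> (real^'n \<Rightarrow> real^'n) \<Rightarrow> real" where
  "degree_integral \<rho> U G = integral U (\<lambda>x. bump \<rho> (G x) * jacobian_det G x)"

lemma degree_integral_homotopy_invariant:
  assumes "open U" "Cn_on 2 U G0" "Cn_on 2 U G1" "compact K" "K \<subseteq> U" "0 \<le> \<rho>"
    and "\<And>x t. x \<in> U - K \<Longrightarrow> t \<in> {0..1} \<Longrightarrow> \<rho> \<le> norm ((1 - t) *\<^sub>R G0 x + t *\<^sub>R G1 x)"
  shows "degree_integral \<rho> U G0 = degree_integral \<rho> U G1"
proof -
  have V: "Cn_on 2 U (\<lambda>x. G1 x - G0 x)" using assms by (intro Cn_on_diff)
  have "G0 x + t *\<^sub>R (G1 x - G0 x) = (1 - t) *\<^sub>R G0 x + t *\<^sub>R G1 x" for x t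
    by (simp add: algebra_simps)
  then have zero: "bump \<rho> (G0 x + t *\<^sub>R (G1 x - G0 x)) = 0 \<and> bump_gradient \<rho> (G0 x + t *\<^sub>R (G1 x - G0 x)) = 0"
    if "x \<in> U - K" "t \<in> {0..1}" for x t
    using bump_eq_0[OF assms(6) assms(7)[OF that]] by simp
  show ?thesis
    using degree_integral_homotopy[OF assms(1,2) V bump_has_derivative continuous_on_bump_gradient assms(4,5) zero]
    by (simp add: degree_integral_def)
qed

lemma degree_integral_restrict:
  assumes "0 \<le> \<rho>" "W \<subseteq> U" "\<And>x. x \<in> U - W \<Longrightarrow> \<rho> \<le> norm (G x)"
  shows "degree_integral \<rho> U G = degree_integral \<rho> W G"
proof -
  let ?f = "\<lambda>x. bump \<rho> (G x) * jacobian_det G x"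
  have "(\<lambda>x. if x \<in> U then ?f x else 0) = (\<lambda>x. if x \<in> W then ?f x else 0)"
    using assms bump_eq_0(1) by (auto simp: fun_eq_iff)
  then show ?thesis
    unfolding degree_integral_def integral_restrict_UNIV[of U ?f, symmetric] integral_restrict_UNIV[of W ?f, symmetric]
    by (rule arg_cong)
qed

section \<open>The degree integral of invertible linear maps\<close>

lemma jacobian_det_affine: "jacobian_det (\<lambda>x. A *v (x - a)) x = det A"
proof -
  have "((\<lambda>x. A *v (x - a)) has_derivative (\<lambda>h. A *v h)) (at x)"
    by (rule has_derivative_eq_rhs[OF bounded_linear.has_derivative[OF matrix_vector_mul_bounded_linear[of A]]])
      (auto intro!: derivative_eq_intros)
  then show ?thesis by (simp add: jacobian_det_def jacobian_def flip: frechet_derivative_at)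
qed

lemma Cn_on_affine: "open U \<Longrightarrow> Cn_on n U (\<lambda>x. A *v (x - a :: real^'n) :: real^'n)"
  unfolding matrix_vector_mult_diff_distrib
  by (intro Cn_on_diff Cn_on_const Cn_on_bounded_linear matrix_vector_mul_bounded_linear)

text \<open>By homogeneity the bound is a minimum over times and unit vectors, a compact set. It
  confines the support of the bump along the whole path to the ball of radius
  \<open>\<rho> / c\<close>.\<close>

lemma matrix_path_lower_bound:
  fixes A B :: "real^'n^'n"
  assumes "\<And>t. t \<in> {0..1} \<Longrightarrow> det ((1 - t) *\<^sub>R A + t *\<^sub>R B) \<noteq> 0"
  obtains c where "c > 0" "\<And>t x. t \<in> {0..1} \<Longrightarrow> c * norm x \<le> norm (((1 - t) *\<^sub>R A + t *\<^sub>R B) *v x)"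
proof -
  let ?M = "\<lambda>t. (1 - t) *\<^sub>R A + t *\<^sub>R B"
  let ?S = "{0..1::real} \<times> sphere (0::real^'n) 1"
  have "compact ?S" by (intro compact_Times) auto
  moreover have "(0, axis undefined 1) \<in> ?S" by simp
  then have "?S \<noteq> {}" by blast
  moreover have "continuous_on ?S (\<lambda>z. norm (?M (fst z) *v snd z))"
    unfolding matrix_vector_mult_def by (intro continuous_intros)
  ultimately obtain z where z: "z \<in> ?S" "\<And>w. w \<in> ?S \<Longrightarrow> norm (?M (fst z) *v snd z) \<le> norm (?M (fst w) *v snd w)"
    using continuous_attains_inf[of ?S "\<lambda>z. norm (?M (fst z) *v snd z)"] by blast
  define c where "c = norm (?M (fst z) *v snd z)"
  have "invertible (?M (fst z))" using assms z by (auto simp: invertible_det_nz)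
  then have "inj ((*v) (?M (fst z)))" by (simp add: inj_matrix_vector_mult)
  then have "?M (fst z) *v snd z \<noteq> 0"
    using z(1) by (auto dest!: injD[where x = "snd z" and y = 0])
  then have "c > 0" by (simp add: c_def)
  moreover have "c * norm x \<le> norm (?M t *v x)" if "t \<in> {0..1}" for t x
  proof (cases "x = 0")
    case False
    have "c \<le> norm (?M t *v ((1 / norm x) *\<^sub>R x))"
      using z(2)[of "(t, (1 / norm x) *\<^sub>R x)"] that False by (simp add: c_def)
    also have "\<dots> = norm (?M t *v x) / norm x"
      using False by (simp add: matrix_vector_mult_scaleR)
    finally show ?thesis using False by (simp add: field_simps)
  qed simp
  ultimately show ?thesis using that by blast
qed

lemma matrix_lower_bound:
  fixes A :: "real^'n^'n"
  assumes "det A \<noteq> 0"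
  obtains c where "c > 0" "\<And>x. c * norm x \<le> norm (A *v x)"
proof -
  have "(1 - t) *\<^sub>R A + t *\<^sub>R A = A" for t by (simp flip: scaleR_add_left)
  then show ?thesis using matrix_path_lower_bound[of A A] that assms by (metis atLeastAtMost_iff order_refl zero_le_one)
qed

lemma degree_integral_linear_path:
  fixes A B :: "real^'n^'n"
  assumes "\<And>t. t \<in> {0..1} \<Longrightarrow> det ((1 - t) *\<^sub>R A + t *\<^sub>R B) \<noteq> 0" "0 \<le> \<rho>"
  shows "degree_integral \<rho> UNIV (\<lambda>x. A *v x) = degree_integral \<rho> UNIV (\<lambda>x. B *v x)"
proof -
  obtain c where c: "c > 0" "\<And>t x. t \<in> {0..1} \<Longrightarrow> c * norm x \<le> norm (((1 - t) *\<^sub>R A + t *\<^sub>R B) *v x)"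
    using matrix_path_lower_bound[OF assms(1)] by metis
  show ?thesis
  proof (rule degree_integral_homotopy_invariant[where K = "cball 0 (\<rho> / c)"])
    show "Cn_on 2 UNIV ((*v) A)" "Cn_on 2 UNIV ((*v) B)"
      using Cn_on_affine[of UNIV 2 _ 0] by auto
    fix x :: "real^'n" and t :: real
    assume x: "x \<in> UNIV - cball 0 (\<rho> / c)" and t: "t \<in> {0..1}"
    have "\<rho> \<le> c * norm x" using x c(1) by (simp add: field_simps)
    also have "\<dots> \<le> norm (((1 - t) *\<^sub>R A + t *\<^sub>R B) *v x)" by (rule c(2)[OF t])
    finally show "\<rho> \<le> norm ((1 - t) *\<^sub>R (A *v x) + t *\<^sub>R (B *v x))"
      by (simp add: matrix_vector_mult_add_rdistrib scaleR_matrix_vector_assoc)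
  qed (use assms in auto)
qed

text \<open>A radial bump does not notice \<open>S\<close>, and the Jacobian determinant is
  constant, so only the factor \<open>det S\<close> remains.\<close>

lemma degree_integral_isometry:
  fixes S B :: "real^'n^'n"
  assumes "\<And>y. norm (S *v y) = norm y"
  shows "degree_integral \<rho> UNIV (\<lambda>x. (S ** B) *v x) = det S * degree_integral \<rho> UNIV (\<lambda>x. B *v x)"
proof -
  have "jacobian_det ((*v) M) x = det M" for M :: "real^'n^'n" and x
    using jacobian_det_affine[of M 0 x] by simp
  moreover have "bump \<rho> ((S ** B) *v x) = bump \<rho> (B *v x)" for x
    using assms by (intro bump_cong_norm) (simp flip: matrix_vector_mul_assoc)
  ultimately show ?thesis
    unfolding degree_integral_def by (simp add: det_mul mult_ac flip: integral_mult_right)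
qed

text \<open>The second factor \<open>B\<close> is carried along for the induction on elementary
  matrices: for a product the hypothesis is used once per factor, with the rest absorbed in
  \<open>B\<close>.\<close>

lemma degree_integral_mult_matrix:
  fixes A :: "real^'n^'n"
  assumes "0 \<le> \<rho>" "det A \<noteq> 0" "det B \<noteq> 0"
  shows "degree_integral \<rho> UNIV (\<lambda>x. (A ** B) *v x) = sgn (det A) * degree_integral \<rho> UNIV (\<lambda>x. B *v x)"
proof -
  let ?D = "\<lambda>A :: real^'n^'n. degree_integral \<rho> UNIV (\<lambda>x. A *v x)"
  have path: "?D (A ** B) = ?D (S ** B)" if "det B \<noteq> 0" "\<And>t. t \<in> {0..1} \<Longrightarrow> det ((1 - t) *\<^sub>R A + t *\<^sub>R S) \<noteq> 0" for A S B :: "real^'n^'n"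
  proof (rule degree_integral_linear_path[OF _ assms(1)])
    fix t :: real assume "t \<in> {0..1}"
    have "(1 - t) *\<^sub>R (A ** B) + t *\<^sub>R (S ** B) = ((1 - t) *\<^sub>R A + t *\<^sub>R S) ** B"
      by (simp add: matrix_matrix_mult_def vec_eq_iff algebra_simps sum.distrib sum_distrib_left sum_subtractf)
    then show "det ((1 - t) *\<^sub>R (A ** B) + t *\<^sub>R (S ** B)) \<noteq> 0"
      using that(1) that(2)[OF \<open>t \<in> _\<close>] by (simp add: det_mul)
  qed
  have "det A \<noteq> 0 \<longrightarrow> (\<forall>B. det B \<noteq> 0 \<longrightarrow> ?D (A ** B) = sgn (det A) * ?D B)" for A :: "real^'n^'n"
  proof (induction A rule: induct_matrix_elementary)
    case (1 A B)
    then show ?case by (auto simp: det_mul sgn_mult simp flip: matrix_mul_assoc)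
  next
    case (2 A i)
    then show ?case using det_zero_row(1)[OF 2] by simp
  next
    case (3 A)
    have diag: "det A = (\<Prod>i\<in>UNIV. A $ i $ i)" using 3 by (rule det_diagonal)
    \<comment> \<open>Each diagonal entry moves to its own sign and does not cross 0 on the
      way.\<close>
    define S :: "real^'n^'n" where "S = (\<chi> i j. if i = j then sgn (A $ i $ i) else 0)"
    show ?case
    proof (intro impI allI)
      fix B :: "real^'n^'n"
      assume "det A \<noteq> 0" "det B \<noteq> 0"
      have nz: "A $ i $ i \<noteq> 0" for i using \<open>det A \<noteq> 0\<close> by (auto simp: diag)
      have "?D (A ** B) = ?D (S ** B)"
      proof (rule path[OF \<open>det B \<noteq> 0\<close>])
        fix t :: real assume t: "t \<in> {0..1}"
        have "det ((1 - t) *\<^sub>R A + t *\<^sub>R S) = (\<Prod>i\<in>UNIV. (1 - t) * A $ i $ i + t * sgn (A $ i $ i))"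
          using 3 by (subst det_diagonal) (auto simp: S_def)
        moreover have "(1 - t) * A $ i $ i + t * sgn (A $ i $ i) \<noteq> 0" for i
        proof -
          have "(1 - t) * A $ i $ i + t * sgn (A $ i $ i) = sgn (A $ i $ i) * ((1 - t) * \<bar>A $ i $ i\<bar> + t)"
            using nz[of i] by (cases "A $ i $ i > 0") (auto simp: algebra_simps)
          moreover have "(1 - t) * \<bar>A $ i $ i\<bar> + t > 0"
            using t nz[of i] by (cases "t = 1") (auto intro!: add_pos_nonneg)
          ultimately show ?thesis using nz[of i] by (simp add: sgn_zero_iff)
        qed
        ultimately show "det ((1 - t) *\<^sub>R A + t *\<^sub>R S) \<noteq> 0" by simp
      qed
      also have "\<dots> = det S * ?D B"
      proof (rule degree_integral_isometry)
        fix y :: "real^'n"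
        have "(S *v y) $ i = sgn (A $ i $ i) * y $ i" for i
          by (simp add: S_def matrix_vector_mult_def if_distrib if_distribR cong: if_cong)
        then have "\<bar>(S *v y) $ i\<bar> = \<bar>y $ i\<bar>" for i using nz[of i] by (simp add: abs_mult)
        then show "norm (S *v y) = norm y" by (simp add: norm_vec_def)
      qed
      also have "det S = (\<Prod>i\<in>UNIV. sgn (A $ i $ i))" by (subst det_diagonal) (auto simp: S_def)
      also have "\<dots> = sgn (det A)"
      proof -
        have "(\<Prod>i\<in>I. sgn (A $ i $ i)) = sgn (\<Prod>i\<in>I. A $ i $ i)" for I
          by (induction I rule: infinite_finite_induct) (auto simp: sgn_mult)
        then show ?thesis by (simp add: diag)
      qed
      finally show "?D (A ** B) = sgn (det A) * ?D B" .
    qed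
  next
    case (4 m n)
    let ?p = "Transposition.transpose m n"
    let ?S = "\<chi> i j. mat 1 $ i $ ?p j :: real^'n^'n"
    have det: "det ?S = -1"
      using det_permute_columns[of ?p "mat 1 :: real^'n^'n"] 4
      by (simp add: permutes_swap_id sign_swap_id)
    \<comment> \<open>A transposition only reorders coordinates, so it is already an
      isometry.\<close>
    have "norm (?S *v y) = norm y" for y
    proof -
      have "(?S *v y) $ i = y $ ?p i" for i
      proof -
        have "(?S *v y) $ i = (\<Sum>j\<in>UNIV. (if j = ?p i then y $ j else 0))"
        proof -
          have "(i = ?p j) = (j = ?p i)" for j by (metis transpose_involutory)
          then show ?thesis
            unfolding matrix_vector_mult_def vec_lambda_beta mat_def
            by (intro sum.cong refl) simp
        qed
        then show ?thesis by simp
      qed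
      moreover have "(\<Sum>i\<in>UNIV. (y $ ?p i)\<^sup>2) = (\<Sum>i\<in>UNIV. (y $ i)\<^sup>2)"
        by (rule sum.reindex_bij_betw) (simp add: permutes_imp_bij permutes_swap_id)
      ultimately show ?thesis by (simp add: norm_vec_def L2_set_def)
    qed
    then show ?case using degree_integral_isometry[of ?S] det by (simp)
  next
    case (5 m n c)
    let ?E = "\<lambda>c. (\<chi> i j. if i = m \<and> j = n then c else of_bool (i = j)) :: real^'n^'n"
    have det: "det (?E c) = 1" for c
    proof -
      have "?E c = (\<chi> k. if k = m then row m (mat 1) + c *s row n (mat 1) else row k (mat 1))"
        using 5 by (auto simp: vec_eq_iff row_def mat_def)
      then show ?thesis using det_row_operation[OF 5, of "mat 1 :: real^'n^'n" c] by simp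
    qed
    \<comment> \<open>A shear contracts to the identity through shears, all of determinant
      1.\<close>
    have "(1 - t) *\<^sub>R ?E c + t *\<^sub>R mat 1 = ?E ((1 - t) * c)" for t
      using 5 by (auto simp: vec_eq_iff mat_def)
    then have "?D (?E c ** B) = ?D (mat 1 ** B)" if "det B \<noteq> 0" for B
      using that by (intro path) (simp_all add: det)
    then show ?case by (simp add: det)
  qed
  then show ?thesis using assms by blast
qed

lemma degree_integral_affine:
  fixes A :: "real^'n^'n"
  assumes "0 \<le> \<rho>" "det A \<noteq> 0"
  shows "degree_integral \<rho> UNIV (\<lambda>x. A *v (x - a)) = sgn (det A) * integral UNIV (bump \<rho> :: real^'n \<Rightarrow> real)"
proof -
  obtain c where c: "c > 0" and c': "\<And>x. c * norm x \<le> norm (A *v x)"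
    using matrix_lower_bound[OF assms(2)] by metis
  have "degree_integral \<rho> UNIV (\<lambda>x. A *v (x - a)) = degree_integral \<rho> UNIV (\<lambda>x. A *v (x - 0))"
  \<comment> \<open>The line homotopy at time \<open>t\<close> is
    \<open>A *v (x - (1 - t) *\<^sub>R a)\<close>; off this ball its argument has norm more than
    \<open>\<rho> / c\<close>.\<close>
  proof (rule degree_integral_homotopy_invariant[where K = "cball 0 (\<rho> / c + norm a)"])
    fix x :: "real^'n" and t :: real
    assume x: "x \<in> UNIV - cball 0 (\<rho> / c + norm a)" and t: "t \<in> {0..1}"
    have "\<rho> \<le> c * (norm x - norm a)" using x c(1) by (simp add: field_simps)
    also have "\<dots> \<le> c * norm (x - (1 - t) *\<^sub>R a)"
    proof (intro mult_left_mono)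
      have "(1 - t) * norm a \<le> norm a" using t by (intro mult_left_le_one_le) auto
      then show "norm x - norm a \<le> norm (x - (1 - t) *\<^sub>R a)"
        using norm_triangle_ineq2[of x "(1 - t) *\<^sub>R a"] t by simp
    qed (use c in auto)
    also have "\<dots> \<le> norm (A *v (x - (1 - t) *\<^sub>R a))" by (rule c')
    also have "A *v (x - (1 - t) *\<^sub>R a) = (1 - t) *\<^sub>R (A *v (x - a)) + t *\<^sub>R (A *v (x - 0))"
      by (simp add: algebra_simps matrix_vector_mult_diff_distrib matrix_vector_mult_scaleR)
    finally show "\<rho> \<le> norm ((1 - t) *\<^sub>R (A *v (x - a)) + t *\<^sub>R (A *v (x - 0)))" .
  qed (use assms Cn_on_affine[OF open_UNIV] in \<open>blast | simp\<close>)+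
  also have "\<dots> = degree_integral \<rho> UNIV (\<lambda>x. (A ** mat 1) *v x)" by simp
  also have "\<dots> = sgn (det A) * degree_integral \<rho> UNIV (\<lambda>x. (mat 1 :: real^'n^'n) *v x)"
    by (rule degree_integral_mult_matrix[OF assms]) simp
  also have "degree_integral \<rho> UNIV (\<lambda>x. (mat 1 :: real^'n^'n) *v x) = integral UNIV (bump \<rho> :: real^'n \<Rightarrow> real)"
    using jacobian_det_affine[of "mat 1 :: real^'n^'n" 0] by (simp add: degree_integral_def)
  finally show ?thesis .
qed

section \<open>Regular zeros\<close>

lemma continuous_on_degree_density:
  assumes "Cn_on 2 U G"
  shows "continuous_on U (\<lambda>x. bump \<rho> (G x) * jacobian_det G x)"
  unfolding jacobian_det_partial1
  by (intro continuous_intros continuous_on_det continuous_on_Cn[OF assms]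
      continuous_on_compose2[OF continuous_on_bump[of UNIV] continuous_on_Cn(1)[OF assms]]) auto

text \<open>The Jacobian matrix stretches by at least some constant, and near \<open>x0\<close> the
  remainder is at most half of that. Along the line from \<open>G\<close> to its linearization only
  the fraction \<open>1 - t\<close> of the remainder is present, so the bound is uniform in
  \<open>t\<close>.\<close>

lemma regular_zero_linear_bound:
  fixes G :: "real^'n \<Rightarrow> real^'n"
  assumes "open U" "x0 \<in> U" "G differentiable (at x0)" "G x0 = 0" "jacobian_det G x0 \<noteq> 0"
  obtains c r where "c > 0" "r > 0" "cball x0 r \<subseteq> U"
    "\<And>x t. x \<in> cball x0 r \<Longrightarrow> t \<in> {0..1} \<Longrightarrow>
       c * norm (x - x0) \<le> norm ((1 - t) *\<^sub>R G x + t *\<^sub>R (jacobian G (at x0) *v (x - x0)))"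
proof -
  let ?A = "jacobian G (at x0)"
  have "det ?A \<noteq> 0" using assms(5) by (simp add: jacobian_det_def)
  then obtain c where c: "c > 0" and c': "\<And>x. c * norm x \<le> norm (?A *v x)"
    using matrix_lower_bound by metis
  have "(G has_derivative (\<lambda>h. ?A *v h)) (at x0)" using assms(3) by (simp add: jacobian_works)
  then obtain d where d: "d > 0"
    "\<And>x. norm (x - x0) < d \<Longrightarrow> norm (G x - G x0 - ?A *v (x - x0)) \<le> c / 2 * norm (x - x0)"
    using c(1) unfolding has_derivative_at_alt by (metis half_gt_zero)
  obtain e where e: "e > 0" "cball x0 e \<subseteq> U" using assms(1,2) open_contains_cball by blast
  define r where "r = min (d / 2) e"
  show ?thesis
  proof (rule that[of "c / 2" r])
    show "cball x0 r \<subseteq> U" using e by (auto simp: r_def)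
    fix x and t :: real assume x: "x \<in> cball x0 r" and t: "t \<in> {0..1}"
    have "norm (x - x0) < d" using x d(1) by (auto simp: r_def dist_norm norm_minus_commute)
    from d(2)[OF this] have 1: "norm (G x - ?A *v (x - x0)) \<le> c / 2 * norm (x - x0)"
      using assms(4) by simp
    have "(1 - t) *\<^sub>R G x + t *\<^sub>R (?A *v (x - x0)) = ?A *v (x - x0) + (1 - t) *\<^sub>R (G x - ?A *v (x - x0))"
      by (simp add: algebra_simps)
    then have "norm ((1 - t) *\<^sub>R G x + t *\<^sub>R (?A *v (x - x0)))
       \<ge> norm (?A *v (x - x0)) - norm ((1 - t) *\<^sub>R (G x - ?A *v (x - x0)))"
      by (metis norm_diff_ineq)
    moreover have "norm ((1 - t) *\<^sub>R (G x - ?A *v (x - x0))) \<le> norm (G x - ?A *v (x - x0))"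
      using t by (simp add: mult_left_le_one_le)
    ultimately show "c / 2 * norm (x - x0) \<le> norm ((1 - t) *\<^sub>R G x + t *\<^sub>R (?A *v (x - x0)))"
      using 1 c'[of "x - x0"] by linarith
  qed (use c d e in \<open>auto simp: r_def\<close>)
qed

text \<open>The radius \<open>s\<close> stays free so that one radius can serve all zeros later. The
  bound \<open>\<rho> \<le> c * s / 2\<close> belongs to the compact set
  \<open>cball x0 (s / 2)\<close>: in the rest of the ball the homotopy to the linearization has
  norm at least \<open>c * s / 2\<close>.\<close>

lemma degree_integral_regular_zero:
  fixes G :: "real^'n \<Rightarrow> real^'n"
  assumes "open U" "Cn_on 2 U G" "x0 \<in> U" "G x0 = 0" "jacobian_det G x0 \<noteq> 0"
  obtains c r where "c > 0" "r > 0" "cball x0 r \<subseteq> U"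
    "\<And>x. x \<in> cball x0 r \<Longrightarrow> c * norm (x - x0) \<le> norm (G x)"
    "\<And>s \<rho>. 0 < s \<Longrightarrow> s \<le> r \<Longrightarrow> 0 \<le> \<rho> \<Longrightarrow> \<rho> \<le> c * s / 2 \<Longrightarrow>
       degree_integral \<rho> (ball x0 s) G = of_int (local_index G x0) * integral UNIV (bump \<rho> :: real^'n \<Rightarrow> real)"
proof -
  let ?A = "jacobian G (at x0)"
  have "Cn_on (Suc 1) U G" using assms(2) by (simp add: eval_nat_numeral)
  then have diff: "G differentiable (at x0)" using assms(3) by simp
  obtain c r where c: "c > 0" "r > 0" "cball x0 r \<subseteq> U" and
    bound: "\<And>x t. x \<in> cball x0 r \<Longrightarrow> t \<in> {0..1} \<Longrightarrow>
       c * norm (x - x0) \<le> norm ((1 - t) *\<^sub>R G x + t *\<^sub>R (?A *v (x - x0)))"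
    using regular_zero_linear_bound[OF assms(1,3) diff assms(4,5)] by metis
  show ?thesis
  proof (rule that[OF c])
    show "c * norm (x - x0) \<le> norm (G x)" if "x \<in> cball x0 r" for x
      using bound[OF that, of 0] by simp
    fix s \<rho> :: real assume s: "0 < s" "s \<le> r" and \<rho>: "0 \<le> \<rho>" "\<rho> \<le> c * s / 2"
    have far: "\<rho> \<le> c * norm (x - x0)" if "x \<notin> cball x0 (s / 2)" for x
    proof -
      have "c * s / 2 \<le> c * norm (x - x0)" using that c(1) by (simp add: dist_norm norm_minus_commute)
      then show ?thesis using \<rho> by simp
    qed
    have "degree_integral \<rho> (ball x0 s) G = degree_integral \<rho> (ball x0 s) (\<lambda>x. ?A *v (x - x0))"
    proof (rule degree_integral_homotopy_invariant[where K = "cball x0 (s / 2)"])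
      show "Cn_on 2 (ball x0 s) G"
        using s c(3) by (intro Cn_on_subset[OF assms(2)]) (auto simp: subset_iff)
      fix x and t :: real assume "x \<in> ball x0 s - cball x0 (s / 2)" "t \<in> {0..1}"
      then show "\<rho> \<le> norm ((1 - t) *\<^sub>R G x + t *\<^sub>R (?A *v (x - x0)))"
        using far[of x] bound[of x t] s by auto
    qed (use s \<rho> in \<open>auto intro: Cn_on_affine\<close>)
    also have "\<dots> = degree_integral \<rho> UNIV (\<lambda>x. ?A *v (x - x0))"
    proof (rule degree_integral_restrict[symmetric])
      fix x assume x: "x \<in> UNIV - ball x0 s"
      \<comment> \<open>The bound for the linear map is known only near \<open>x0\<close>; the
        factor \<open>k\<close> moves \<open>x\<close> to distance \<open>s\<close> from
        \<open>x0\<close>, and homogeneity carries the bound back.\<close>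
      define k where "k = s / norm (x - x0)"
      have n: "norm (x - x0) \<ge> s" using x by (auto simp: dist_norm norm_minus_commute)
      have "norm (x - x0) > 0" using n s by linarith
      then have k: "0 < k" "k \<le> 1" using n s by (simp_all add: k_def)
      have "x0 + k *\<^sub>R (x - x0) \<in> cball x0 r" using n s by (simp add: dist_norm k_def)
      from bound[OF this, of 1] have "c * norm (k *\<^sub>R (x - x0)) \<le> norm (?A *v (k *\<^sub>R (x - x0)))" by simp
      then have "c * norm (x - x0) \<le> norm (?A *v (x - x0))"
        using k by (simp add: matrix_vector_mult_scaleR)
      moreover have "x \<notin> cball x0 (s / 2)" using x s by auto
      ultimately show "\<rho> \<le> norm (?A *v (x - x0))" using far[of x] by linarith
    qed (use \<rho> in auto)
    also have "\<dots> = sgn (det ?A) * integral UNIV (bump \<rho> :: real^'n \<Rightarrow> real)"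
      using assms(5) \<rho> by (intro degree_integral_affine) (auto simp: jacobian_det_def)
    also have "sgn (det ?A) = of_int (local_index G x0)"
      using assms(5) by (auto simp: local_index_def jacobian_det_def sgn_if)
    finally show "degree_integral \<rho> (ball x0 s) G =
       of_int (local_index G x0) * integral UNIV (bump \<rho> :: real^'n \<Rightarrow> real)" .
  qed
qed

lemma finite_pos_lower_bound:
  fixes f :: "'a \<Rightarrow> real"
  assumes "finite A" "\<And>a. a \<in> A \<Longrightarrow> f a > 0"
  obtains e where "e > 0" "\<And>a. a \<in> A \<Longrightarrow> e \<le> f a"
\<comment> \<open>The inserted 1 covers the empty set.\<close>
proof (rule that[of "Min (insert 1 (f ` A))"])
  show "0 < Min (insert 1 (f ` A))" using assms by (subst Min_gr_iff) auto
qed (use assms in auto)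

lemma compact_pos_lower_bound:
  fixes f :: "'a::metric_space \<Rightarrow> real"
  assumes "compact A" "continuous_on A f" "\<And>a. a \<in> A \<Longrightarrow> f a > 0"
  obtains e where "e > 0" "\<And>a. a \<in> A \<Longrightarrow> e \<le> f a"
proof (cases "A = {}")
  case True
  then show ?thesis using that[of 1] by auto
next
  case False
  then obtain a where "a \<in> A" "\<And>b. b \<in> A \<Longrightarrow> f a \<le> f b"
    using continuous_attains_inf[OF assms(1) False assms(2)] by blast
  then show ?thesis using that[of "f a"] assms(3) by blast
qed

text \<open>The linear bound isolates each zero, and all zeros lie in the compact \<open>K\<close>,
  so they cannot accumulate and are finite in number. For small \<open>\<rho>\<close> the bump sees
  only disjoint balls around them.\<close>

lemma degree_integral_eq_sum_local_index:
  fixes G :: "real^'n \<Rightarrow> real^'n"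
  assumes U: "open U" and G: "Cn_on 2 U G" and K: "compact K" "K \<subseteq> U"
    and \<rho>1: "\<rho>1 > 0" "\<And>x. x \<in> U - K \<Longrightarrow> \<rho>1 \<le> norm (G x)"
    and reg: "\<And>x. x \<in> U \<Longrightarrow> G x = 0 \<Longrightarrow> jacobian_det G x \<noteq> 0"
  obtains \<rho>0 where "finite {x \<in> U. G x = 0}" "\<rho>0 > 0"
    "\<And>\<rho>. 0 < \<rho> \<Longrightarrow> \<rho> \<le> \<rho>0 \<Longrightarrow> degree_integral \<rho> U G =
       of_int (\<Sum>x\<in>{x \<in> U. G x = 0}. local_index G x) * integral UNIV (bump \<rho> :: real^'n \<Rightarrow> real)"
proof -
  define Z where "Z = {x \<in> U. G x = 0}"
  let ?B = "\<lambda>\<rho>. integral UNIV (bump \<rho> :: real^'n \<Rightarrow> real)"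
  have contK: "continuous_on K G" using continuous_on_Cn(1)[OF G] K(2) continuous_on_subset by blast
  have "\<exists>c r. c > 0 \<and> r > 0 \<and> cball z r \<subseteq> U \<and>
      (\<forall>x\<in>cball z r. c * norm (x - z) \<le> norm (G x)) \<and>
      (\<forall>s \<rho>. 0 < s \<longrightarrow> s \<le> r \<longrightarrow> 0 \<le> \<rho> \<longrightarrow> \<rho> \<le> c * s / 2 \<longrightarrow>
         degree_integral \<rho> (ball z s) G = of_int (local_index G z) * ?B \<rho>)" if "z \<in> Z" for z
  proof -
    have z: "z \<in> U" "G z = 0" using that by (auto simp: Z_def)
    show ?thesis using degree_integral_regular_zero[OF U G z reg[OF z]] by metis
  qed
  then obtain c where "\<forall>z\<in>Z. \<exists>r. c z > 0 \<and> r > 0 \<and> cball z r \<subseteq> U \<and>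
      (\<forall>x\<in>cball z r. c z * norm (x - z) \<le> norm (G x)) \<and>
      (\<forall>s \<rho>. 0 < s \<longrightarrow> s \<le> r \<longrightarrow> 0 \<le> \<rho> \<longrightarrow> \<rho> \<le> c z * s / 2 \<longrightarrow>
         degree_integral \<rho> (ball z s) G = of_int (local_index G z) * ?B \<rho>)"
    using bchoice[of Z] by (metis (no_types, lifting))
  from bchoice[OF this] obtain r where cr: "\<And>z. z \<in> Z \<Longrightarrow> c z > 0" "\<And>z. z \<in> Z \<Longrightarrow> r z > 0" "\<And>z. z \<in> Z \<Longrightarrow> cball z (r z) \<subseteq> U"
      "\<And>z x. z \<in> Z \<Longrightarrow> x \<in> cball z (r z) \<Longrightarrow> c z * norm (x - z) \<le> norm (G x)"
      "\<And>z s \<rho>. z \<in> Z \<Longrightarrow> 0 < s \<Longrightarrow> s \<le> r z \<Longrightarrow> 0 \<le> \<rho> \<Longrightarrow> \<rho> \<le> c z * s / 2 \<Longrightarrow>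
         degree_integral \<rho> (ball z s) G = of_int (local_index G z) * ?B \<rho>"
    by blast
  have isolated: "x = z" if "z \<in> Z" "x \<in> Z" "x \<in> cball z (r z)" for x z
    using cr(4)[OF that(1,3)] cr(1)[OF that(1)] that(2) by (simp add: Z_def mult_le_0_iff)
  have ZK: "Z = K \<inter> G -` {0}" using \<rho>1 K by (force simp: Z_def)
  have "finite Z"
  proof (rule ccontr)
    assume "infinite Z"
    have "closed Z"
      unfolding ZK by (rule continuous_closed_preimage[OF contK]) (use K in \<open>auto simp: compact_imp_closed\<close>)
    then have "compact Z" using compact_Int_closed[OF K(1)] ZK by (metis inf.absorb_iff2 inf_le1)
    then obtain z where z: "z \<in> Z" "z islimpt Z"
      using \<open>infinite Z\<close> compact_eq_Bolzano_Weierstrass by blast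
    then obtain x where "x \<in> Z" "x \<in> ball z (r z)" "x \<noteq> z"
      using cr(2)[OF z(1)] unfolding islimpt_def by (metis centre_in_ball open_ball)
    then show False using isolated[OF z(1)] by auto
  qed
  obtain r0 where r0: "r0 > 0" "\<And>z. z \<in> Z \<Longrightarrow> r0 \<le> r z" using finite_pos_lower_bound[of Z r] \<open>finite Z\<close> cr(2) by metis
  obtain c0 where c0: "c0 > 0" "\<And>z. z \<in> Z \<Longrightarrow> c0 \<le> c z" using finite_pos_lower_bound[of Z c] \<open>finite Z\<close> cr(1) by metis
  \<comment> \<open>Since \<open>2 * s\<close> is at most every \<open>r z\<close>, a point common
    to two balls puts one centre into the isolating ball of the other.\<close>
  define s where "s = r0 / 2"
  have "s > 0" "s \<le> r z" "2 * s \<le> r z" if "z \<in> Z" for z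
    using r0(1) r0(2)[OF that] by (auto simp: s_def)
  moreover have "s > 0" using r0(1) by (simp add: s_def)
  ultimately have s: "s > 0" "\<And>z. z \<in> Z \<Longrightarrow> s \<le> r z" "\<And>z. z \<in> Z \<Longrightarrow> 2 * s \<le> r z"
    by blast+
  have disj: "z = z'" if "z \<in> Z" "z' \<in> Z" "x \<in> ball z s" "x \<in> ball z' s" for x z z'
  proof -
    have "dist z z' \<le> 2 * s" using that dist_triangle2[of z z' x] by (auto simp: dist_commute)
    then have "z' \<in> cball z (r z)" using s(3)[OF that(1)] by simp
    then show ?thesis using isolated that by metis
  qed
  define W where "W = (\<Union>z\<in>Z. ball z s)"
  have WU: "W \<subseteq> U" using cr(3) s(2) unfolding W_def by (force simp: subset_iff)
  have "compact (K - W)" by (intro compact_diff K) (auto simp: W_def)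
  moreover have "continuous_on (K - W) (\<lambda>x. norm (G x))"
    by (intro continuous_intros continuous_on_subset[OF contK]) auto
  moreover have "norm (G x) > 0" if "x \<in> K - W" for x
    using that K(2) s(1) by (force simp: Z_def W_def)
  ultimately obtain \<rho>2 where \<rho>2: "\<rho>2 > 0" "\<And>x. x \<in> K - W \<Longrightarrow> \<rho>2 \<le> norm (G x)"
    using compact_pos_lower_bound by metis
  \<comment> \<open>\<open>\<rho>1\<close> handles \<open>U - K\<close>, \<open>\<rho>2\<close>
    handles \<open>K - W\<close>, and below \<open>c0 * s / 2\<close> each ball contributes its
    local index.\<close>
  define \<rho>0 where "\<rho>0 = min (min \<rho>1 \<rho>2) (c0 * s / 2)"
  have "degree_integral \<rho> U G = of_int (\<Sum>x\<in>Z. local_index G x) * ?B \<rho>" if \<rho>: "0 < \<rho>" "\<rho> \<le> \<rho>0" for \<rho>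
  proof -
    let ?f = "\<lambda>x. bump \<rho> (G x) * jacobian_det G x"
    have le: "\<rho> \<le> c z * s / 2" if "z \<in> Z" for z
    proof -
      have "\<rho> \<le> c0 * s / 2" using \<rho> by (simp add: \<rho>0_def)
      also have "\<dots> \<le> c z * s / 2" using c0(2)[OF that] s(1) by simp
      finally show ?thesis .
    qed
    have "degree_integral \<rho> U G = degree_integral \<rho> W G"
      using \<rho> \<rho>1 \<rho>2 WU by (intro degree_integral_restrict) (force simp: \<rho>0_def)+
    also have "\<dots> = integral UNIV (\<lambda>x. if x \<in> W then ?f x else 0)"
      by (simp add: degree_integral_def integral_restrict_UNIV)
    also have "(\<lambda>x. if x \<in> W then ?f x else 0) = (\<lambda>x. \<Sum>z\<in>Z. if x \<in> ball z s then ?f x else 0)"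
    proof
      fix x
      show "(if x \<in> W then ?f x else 0) = (\<Sum>z\<in>Z. if x \<in> ball z s then ?f x else 0)"
      proof (cases "x \<in> W")
        case True
        then obtain w where w: "w \<in> Z" "x \<in> ball w s" by (auto simp: W_def)
        have "(\<Sum>z\<in>Z. if x \<in> ball z s then ?f x else 0) = (\<Sum>z\<in>Z. if z = w then ?f x else 0)"
          using w disj by (intro sum.cong refl) auto
        then show ?thesis using True w \<open>finite Z\<close> by simp
      next
        case False
        then show ?thesis by (auto simp: W_def intro!: sum.neutral[symmetric])
      qed
    qed
    also have "integral UNIV \<dots> = (\<Sum>z\<in>Z. integral UNIV (\<lambda>x. if x \<in> ball z s then ?f x else 0))"
    proof (rule integral_sum[OF \<open>finite Z\<close>])
      fix z assume z: "z \<in> Z"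
      have sub: "ball z s \<subseteq> cball z (r z)" using s(2)[OF z] by (auto simp: subset_iff)
      have "?f integrable_on ball z s"
      proof (rule integrable_extend_zero[where K = "cball z (s / 2)"])
        show "continuous_on (ball z s) ?f"
          using continuous_on_degree_density[OF G] sub cr(3)[OF z] by (blast intro: continuous_on_subset)
        fix x assume x: "x \<in> ball z s - cball z (s / 2)"
        have "c z * (s / 2) \<le> c z * norm (x - z)"
          using x cr(1)[OF z] by (intro mult_left_mono) (auto simp: dist_norm norm_minus_commute)
        also have "\<dots> \<le> norm (G x)" using x sub by (intro cr(4)[OF z]) auto
        finally show "?f x = 0" using le[OF z] \<rho> bump_eq_0(1)[of \<rho> "G x"] by simp
      qed (use s in auto)
      then show "(\<lambda>x. if x \<in> ball z s then ?f x else 0) integrable_on UNIV"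
        by (simp only: integrable_restrict_UNIV)
    qed
    also have "\<dots> = (\<Sum>z\<in>Z. degree_integral \<rho> (ball z s) G)"
      by (simp only: integral_restrict_UNIV degree_integral_def)
    also have "\<dots> = (\<Sum>z\<in>Z. of_int (local_index G z) * ?B \<rho>)"
      using cr(5) s le \<rho> by (intro sum.cong refl) simp
    finally show ?thesis by (simp add: sum_distrib_right)
  qed
  moreover have "\<rho>0 > 0" using \<rho>1 \<rho>2 c0 s by (simp add: \<rho>0_def)
  ultimately show ?thesis using that \<open>finite Z\<close> unfolding Z_def by blast
qed

text \<open>One \<open>\<rho>\<close>, small enough for both index formulas and at most
  \<open>\<delta>\<close>, links the two sums through the homotopy; the positive integral of the
  bump is then divided out.\<close>

lemma sum_local_index_homotopy_invariant:
  fixes G0 G1 :: "real^'n \<Rightarrow> real^'n"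
  assumes U: "open U" and G: "Cn_on 2 U G0" "Cn_on 2 U G1" and K: "compact K" "K \<subseteq> U" and "\<delta> > 0"
    and far: "\<And>x t. x \<in> U - K \<Longrightarrow> t \<in> {0..1} \<Longrightarrow> \<delta> \<le> norm ((1 - t) *\<^sub>R G0 x + t *\<^sub>R G1 x)"
    and reg: "\<And>x. x \<in> U \<Longrightarrow> G0 x = 0 \<Longrightarrow> jacobian_det G0 x \<noteq> 0"
      "\<And>x. x \<in> U \<Longrightarrow> G1 x = 0 \<Longrightarrow> jacobian_det G1 x \<noteq> 0"
  shows "(\<Sum>x\<in>{x \<in> U. G0 x = 0}. local_index G0 x) = (\<Sum>x\<in>{x \<in> U. G1 x = 0}. local_index G1 x)"
proof -
  let ?B = "\<lambda>\<rho>. integral UNIV (bump \<rho> :: real^'n \<Rightarrow> real)"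
  have "\<delta> \<le> norm (G0 x)" if "x \<in> U - K" for x using far[OF that, of 0] by simp
  then obtain \<rho>0 where "finite {x \<in> U. G0 x = 0}" and \<rho>0: "\<rho>0 > 0" "\<And>\<rho>. 0 < \<rho> \<Longrightarrow> \<rho> \<le> \<rho>0 \<Longrightarrow>
      degree_integral \<rho> U G0 = of_int (\<Sum>x\<in>{x \<in> U. G0 x = 0}. local_index G0 x) * ?B \<rho>"
    using degree_integral_eq_sum_local_index[OF U G(1) K \<open>\<delta> > 0\<close> _ reg(1)] by blast
  have "\<delta> \<le> norm (G1 x)" if "x \<in> U - K" for x using far[OF that, of 1] by simp
  then obtain \<rho>1 where "finite {x \<in> U. G1 x = 0}" and \<rho>1: "\<rho>1 > 0" "\<And>\<rho>. 0 < \<rho> \<Longrightarrow> \<rho> \<le> \<rho>1 \<Longrightarrow>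
      degree_integral \<rho> U G1 = of_int (\<Sum>x\<in>{x \<in> U. G1 x = 0}. local_index G1 x) * ?B \<rho>"
    using degree_integral_eq_sum_local_index[OF U G(2) K \<open>\<delta> > 0\<close> _ reg(2)] by blast
  define \<rho> where "\<rho> = min \<delta> (min \<rho>0 \<rho>1)"
  have \<rho>: "0 < \<rho>" "\<rho> \<le> \<rho>0" "\<rho> \<le> \<rho>1" "\<rho> \<le> \<delta>" using \<open>\<delta> > 0\<close> \<rho>0(1) \<rho>1(1) by (auto simp: \<rho>_def)
  have "degree_integral \<rho> U G0 = degree_integral \<rho> U G1"
    by (rule degree_integral_homotopy_invariant[OF U G K]) (use \<rho> far in \<open>auto intro: order_trans[of _ \<delta>]\<close>)
  then show ?thesis
    using \<rho>0(2)[OF \<rho>(1,2)] \<rho>1(2)[OF \<rho>(1,3)] integral_bump_pos[OF \<rho>(1), where 'n = 'n]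
    by (simp flip: of_int_sum)
qed

section \<open>Smooth approximation and regular values\<close>

text \<open>Sard's theorem of the library is restricted to index types of class \<^class>\<open>wellorder\<close>; an
  arbitrary finite index type is moved to a copy carrying a well-order pulled back from \<^typ>\<open>nat\<close>.\<close>

typedef 'a ordered_copy = "UNIV :: 'a set"
  by simp

instance ordered_copy :: (finite) finite
proof
  have "UNIV = range (Abs_ordered_copy :: 'a \<Rightarrow> _)"
    by (metis (mono_tags) Rep_ordered_copy_inverse surjI)
  then show "finite (UNIV :: 'a ordered_copy set)" by (metis finite finite_imageI)
qed

definition ordered_copy_index :: "'a::finite ordered_copy \<Rightarrow> nat" where
  "ordered_copy_index = (SOME f. inj f)"

lemma inj_ordered_copy_index: "inj (ordered_copy_index :: 'a::finite ordered_copy \<Rightarrow> nat)"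
proof -
  have "\<exists>f :: 'a ordered_copy \<Rightarrow> nat. inj f"
    using finite_imp_inj_to_nat_seg[of "UNIV :: 'a ordered_copy set"] finite by blast
  then show ?thesis unfolding ordered_copy_index_def by (rule someI_ex)
qed

instantiation ordered_copy :: (finite) wellorder
begin

definition less_eq_ordered_copy :: "'a ordered_copy \<Rightarrow> 'a ordered_copy \<Rightarrow> bool" where
  "less_eq_ordered_copy x y \<longleftrightarrow> ordered_copy_index x \<le> ordered_copy_index y"

definition less_ordered_copy :: "'a ordered_copy \<Rightarrow> 'a ordered_copy \<Rightarrow> bool" where
  "less_ordered_copy x y \<longleftrightarrow> ordered_copy_index x < ordered_copy_index y"

instance
proof
  fix P :: "'a ordered_copy \<Rightarrow> bool" and a :: "'a ordered_copy"
  assume *: "\<And>x. (\<And>y. y < x \<Longrightarrow> P y) \<Longrightarrow> P x"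
  show "P a"
    by (induction a rule: measure_induct_rule[of ordered_copy_index])
      (auto intro: * simp: less_ordered_copy_def)
qed (auto simp: less_eq_ordered_copy_def less_ordered_copy_def dest: injD[OF inj_ordered_copy_index])

end

lemma bij_Rep_ordered_copy: "bij Rep_ordered_copy"
  by (rule o_bij[of Abs_ordered_copy]) (auto simp: fun_eq_iff Abs_ordered_copy_inverse Rep_ordered_copy_inverse)

definition to_copy :: "real^'n \<Rightarrow> real^('n ordered_copy)" where
  "to_copy x = (\<chi> i. x $ Rep_ordered_copy i)"

definition from_copy :: "real^('n ordered_copy) \<Rightarrow> real^'n" where
  "from_copy x = (\<chi> i. x $ Abs_ordered_copy i)"

lemma from_copy_to_copy [simp]: "from_copy (to_copy x) = x"
  by (simp add: from_copy_def to_copy_def Abs_ordered_copy_inverse)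

lemma bounded_linear_copy: "bounded_linear to_copy" "bounded_linear from_copy"
  by (auto intro!: linear_conv_bounded_linear[THEN iffD1] linearI simp: to_copy_def from_copy_def vec_eq_iff)

lemma negligible_critical_values:
  fixes f :: "real^'n \<Rightarrow> real^'n"
  assumes der: "\<And>x. x \<in> S \<Longrightarrow> (f has_derivative f' x) (at x)"
    and crit: "\<And>x. x \<in> S \<Longrightarrow> det (matrix (f' x)) = 0"
  shows "negligible (f ` S)"
proof -
  let ?g = "\<lambda>x. to_copy (f (from_copy x))" and ?g' = "\<lambda>x h. to_copy (f' (from_copy x) (from_copy h))"
  have N: "negligible (?g ` (to_copy ` S))"
  proof (rule baby_Sard)
    fix x assume "x \<in> to_copy ` S"
    then have x: "from_copy x \<in> S" by auto
    have "(from_copy has_derivative from_copy) (at x within to_copy ` S)"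
      by (rule bounded_linear_imp_has_derivative[OF bounded_linear_copy(2)])
    from has_derivative_compose[OF this der[OF x]]
    show der_g: "(?g has_derivative ?g' x) (at x within to_copy ` S)"
      by (rule bounded_linear.has_derivative[OF bounded_linear_copy(1)])
    have lin: "linear (f' (from_copy x))" using has_derivative_linear[OF der[OF x]] .
    have lin': "linear (?g' x)" using has_derivative_linear[OF der_g] .
    have "\<not> inj (?g' x)"
    proof
      assume *: "inj (?g' x)"
      have "inj (f' (from_copy x))"
      proof (rule injI)
        fix a b assume "f' (from_copy x) a = f' (from_copy x) b"
        then have "?g' x (to_copy a) = ?g' x (to_copy b)" by simp
        then have "to_copy a = to_copy b" by (rule injD[OF *])
        then show "a = b" by (metis from_copy_to_copy)
      qed
      then show False using crit[OF x] det_nz_iff_inj[OF lin] by simp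
    qed
    then show "rank (matrix (?g' x)) < CARD('n ordered_copy)"
      using full_rank_injective[of "matrix (?g' x)"] rank_bound[of "matrix (?g' x)"]
      by (simp add: matrix_vector_mul(2)[OF lin'] order_less_le)
  qed simp
  have card: "CARD('n ordered_copy) = CARD('n)"
    by (rule bij_betw_same_card[OF bij_Rep_ordered_copy])
  \<comment> \<open>A differentiable map between spaces of equal dimension keeps null sets null,
    which brings the result back to the original index type.\<close>
  have "negligible (from_copy ` (?g ` (to_copy ` S)))"
  proof (rule negligible_differentiable_image_negligible[OF _ N])
    show "from_copy differentiable_on ?g ` (to_copy ` S)"
      by (rule linear_imp_differentiable_on) (use bounded_linear_copy(2) in \<open>simp add: linear_conv_bounded_linear\<close>)
  qed (simp add: card)
  then show ?thesis by (simp add: image_image)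
qed

text \<open>A ball is not a null set, so the critical values cannot cover it.\<close>

lemma regular_value_near:
  fixes f :: "real^'n \<Rightarrow> real^'n"
  assumes "\<And>x. x \<in> S \<Longrightarrow> f differentiable (at x)" "\<delta> > 0"
  obtains z where "norm (z - y) < \<delta>" "\<And>x. x \<in> S \<Longrightarrow> f x = z \<Longrightarrow> jacobian_det f x \<noteq> 0"
proof -
  let ?C = "{x \<in> S. jacobian_det f x = 0}"
  have "negligible (f ` ?C)"
  proof (rule negligible_critical_values)
    fix x assume "x \<in> ?C"
    then show "(f has_derivative frechet_derivative f (at x)) (at x)" "det (matrix (frechet_derivative f (at x))) = 0"
      using assms(1) by (auto simp: frechet_derivative_works[symmetric] jacobian_det_def jacobian_def)
  qed
  then have "\<not> ball y \<delta> \<subseteq> f ` ?C"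
    using open_not_negligible[of "ball y \<delta>"] negligible_subset assms(2) by auto
  then obtain z where z: "z \<in> ball y \<delta>" "z \<notin> f ` ?C" by blast
  show ?thesis
    by (rule that[of z]) (use z in \<open>auto simp: dist_norm norm_minus_commute\<close>)
qed

text \<open>Polynomial approximation is uniform only on bounded sets, so the polynomial has to
  change with the distance from 0. At each point the result is a convex combination of two good
  approximations. Distance is measured by \<open>x \<bullet> x\<close>, which unlike the norm is
  smooth at 0.\<close>

lemma smooth_approximation:
  fixes f :: "'a::euclidean_space \<Rightarrow> 'b::euclidean_space"
  assumes "continuous_on UNIV f" "e > 0"
  obtains g where "\<And>n. Cn_on n UNIV g" "\<And>x. norm (g x - f x) \<le> e"
proof -
  \<comment> \<open>The radius \<open>n + 2\<close> contains the region
    \<open>x \<bullet> x \<le> n + 1\<close>, where \<open>p n\<close> is still in use.\<close>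
  have "\<exists>p. polynomial_function p \<and> (\<forall>x\<in>cball 0 (real n + 2). norm (f x - p x) < e)" for n
    using assms by (intro Stone_Weierstrass_polynomial_function) (auto intro: continuous_on_subset)
  then obtain p where p: "\<And>n. polynomial_function (p n)"
    "\<And>n x. norm x \<le> real n + 2 \<Longrightarrow> norm (f x - p n x) < e"
    by (metis dist_0_norm mem_cball)
  \<comment> \<open>\<open>G N\<close> interpolates from \<open>p n\<close> to \<open>p (Suc n)\<close> on the annulus \<open>n \<le> \<bar>x\<bar>\<^sup>2 \<le> n + 1\<close>.\<close>
  define u where "u = (\<lambda>n x. smooth_step (x \<bullet> x - real n) *\<^sub>R (p (Suc n) x - p n x))"
  define G where "G = (\<lambda>N x. p 0 x + (\<Sum>n<N. u n x))"
  define g where "g = (\<lambda>x. G (nat \<lceil>x \<bullet> x\<rceil>) x)"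
  have u0: "u n x = 0" if "x \<bullet> x \<le> real n" for n x
    using that by (simp add: u_def smooth_step_eq_0)
  have stable: "G N x = g x" if "x \<bullet> x \<le> real N" for N x
  proof -
    let ?M = "nat \<lceil>x \<bullet> x\<rceil>"
    have M: "?M \<le> N" using that by linarith
    have "(\<Sum>n<N. u n x) = (\<Sum>n<?M. u n x)"
    proof (rule sum.mono_neutral_right)
      show "\<forall>n\<in>{..<N} - {..<?M}. u n x = 0"
        by (auto intro!: u0)
    qed (use M in auto)
    then show ?thesis by (simp add: G_def g_def)
  qed
  have Cu: "Cn_on k UNIV (u n)" for k n
  proof -
    have sq: "Cn_on k UNIV (\<lambda>x::'a. x \<bullet> x)"
    proof -
      have "Cn_on k UNIV (\<lambda>x::'a. \<Sum>b\<in>Basis. (x \<bullet> b) * (x \<bullet> b))"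
        by (intro Cn_on_sum Cn_on_mult Cn_on_bounded_linear bounded_linear_inner_left) auto
      then show ?thesis by (simp add: euclidean_inner[symmetric])
    qed
    show ?thesis
      unfolding u_def
      by (intro Cn_on_scaleR Cn_on_smooth_step Cn_on_diff[OF _ sq] Cn_on_const
          Cn_on_diff[OF _ Cn_on_polynomial_function Cn_on_polynomial_function] p open_UNIV)
  qed
  have CG: "Cn_on k UNIV (G N)" for k N
    unfolding G_def by (intro Cn_on_add Cn_on_sum Cn_on_polynomial_function p Cu) auto
  have Cg: "Cn_on k UNIV g" for k
  proof -
    have "Cn_on k {x. x \<bullet> x < real N} g" for N
    proof (rule Cn_on_cong)
      show "open {x::'a. x \<bullet> x < real N}" by (intro open_Collect_less continuous_intros)
      show "G N x = g x" if "x \<in> {x. x \<bullet> x < real N}" for x using stable that by simp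
    qed (rule Cn_on_subset[OF CG], simp)
    moreover have "(\<Union>N. {x::'a. x \<bullet> x < real N}) = UNIV" by (auto simp: reals_Archimedean2)
    ultimately show ?thesis using Cn_on_UN[of "\<lambda>N. {x. x \<bullet> x < real N}" k g]
      by (simp add: open_Collect_less continuous_on_inner)
  qed
  have G_Suc: "G (Suc N) x = G N x + u N x" for N x by (simp add: G_def)
  have near: "norm (G N x - f x) \<le> e" if "x \<bullet> x \<le> real N" for N x
    using that
  proof (induction N)
    case 0
    then have "x = 0" by (metis inner_eq_zero_iff inner_ge_zero of_nat_0 order_antisym)
    then show ?case using p(2)[of x 0] by (simp add: G_def norm_minus_commute less_imp_le)
  next
    case (Suc N)
    \<comment> \<open>From \<open>x \<bullet> x \<ge> M\<close> on, the first \<open>M\<close> steps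
      are fully switched on and the sum telescopes to \<open>p M\<close>.\<close>
    have full: "G M x = p M x" if "real M \<le> x \<bullet> x" for M
      using that
    proof (induction M)
      case (Suc M)
      have "smooth_step (x \<bullet> x - real M) = 1" using Suc.prems by (intro smooth_step_eq_1) simp
      moreover have "G M x = p M x" using Suc by simp
      ultimately show ?case by (simp add: G_Suc u_def)
    qed (simp add: G_def)
    show ?case
    proof (cases "x \<bullet> x \<le> real N")
      case True
      then have "G (Suc N) x = G N x" using u0 by (simp add: G_Suc)
      then show ?thesis using Suc.IH True by simp
    next
      case False
      let ?s = "smooth_step (x \<bullet> x - real N)"
      have "norm x \<le> real N + 2"
      proof (rule power2_le_imp_le)
        have "(norm x)\<^sup>2 \<le> real N + 1" using Suc.prems by (simp add: power2_norm_eq_inner)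
        also have "\<dots> \<le> (real N + 2)\<^sup>2" by (simp add: power2_eq_square algebra_simps)
        finally show "(norm x)\<^sup>2 \<le> (real N + 2)\<^sup>2" .
      qed simp
      then have b: "norm (p N x - f x) \<le> e" "norm (p (Suc N) x - f x) \<le> e"
        using p(2)[of x N] p(2)[of x "Suc N"] by (simp_all add: norm_minus_commute)
      have "G (Suc N) x - f x = (1 - ?s) *\<^sub>R (p N x - f x) + ?s *\<^sub>R (p (Suc N) x - f x)"
        using full[of N] False by (simp add: G_Suc u_def algebra_simps)
      also have "norm \<dots> \<le> (1 - ?s) * norm (p N x - f x) + ?s * norm (p (Suc N) x - f x)"
        using norm_triangle_ineq smooth_step_bounds[of "x \<bullet> x - real N"] by (metis abs_of_nonneg diff_ge_0_iff_ge norm_scaleR)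
      also have "\<dots> \<le> (1 - ?s) * e + ?s * e"
        using b smooth_step_bounds[of "x \<bullet> x - real N"] by (intro add_mono mult_left_mono) auto
      finally show ?thesis by (simp add: algebra_simps)
    qed
  qed
  have "norm (g x - f x) \<le> e" for x
    using near[of x "nat \<lceil>x \<bullet> x\<rceil>"] by (simp add: g_def real_nat_ceiling_ge)
  then show ?thesis using that Cg by blast
qed

section \<open>The Brouwer degree\<close>

lemma smooth_on_closure_imp_Cn_on:
  assumes "open U" "smooth_on (closure U) g"
  shows "Cn_on n U g"
proof -
  obtain V h where V: "closure U \<subseteq> V" "Cn_on n V h" "\<And>x. x \<in> closure U \<Longrightarrow> h x = g x"
    using assms(2) unfolding smooth_on_def by metis
  have "U \<subseteq> V" using V(1) closure_subset by blast
  then have "Cn_on n U h" using Cn_on_subset V(2) by blast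
  then show ?thesis
    by (rule Cn_on_cong[OF assms(1), rotated]) (use V(3) closure_subset in blast)
qed

text \<open>Both functions have the same derivatives at every point, so
  \<open>frechet_derivative\<close> makes the same choice for both, even where neither is
  differentiable.\<close>

lemma jacobian_det_diff_const: "jacobian_det (\<lambda>x. g x - z) x = jacobian_det g x"
proof -
  have "((\<lambda>x. g x - z) has_derivative D) (at x) \<longleftrightarrow> (g has_derivative D) (at x)" for D
    using has_derivative_add_const[of "\<lambda>x. g x - z" D "at x" z] has_derivative_add_const[of g D "at x" "- z"] by auto
  then show ?thesis by (simp add: jacobian_det_def jacobian_def frechet_derivative_def)
qed

lemma regular_degree_eq_sum_zeros:
  "regular_degree g U z = (\<Sum>x\<in>{x \<in> U. g x - z = 0}. local_index (\<lambda>x. g x - z) x)"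
proof -
  have "g -` {z} \<inter> U = {x \<in> U. g x - z = 0}" by auto
  moreover have "local_index (\<lambda>x. g x - z) x = local_index g x" for x
    unfolding local_index_def jacobian_det_diff_const ..
  ultimately show ?thesis by (simp add: regular_degree_def)
qed

text \<open>Properness replaces compactness of \<open>C\<close>: the part where \<open>f\<close> is
  within 1 of \<open>y\<close> is compact, and elsewhere the distance exceeds 1.\<close>

lemma admissible_lower_bound:
  assumes "admissible f U y" "closed C" "C \<subseteq> closure U" "\<And>x. x \<in> C \<Longrightarrow> f x \<noteq> y"
  obtains \<delta> where "\<delta> > 0" "\<And>x. x \<in> C \<Longrightarrow> \<delta> \<le> norm (f x - y)"
proof -
  let ?L = "C \<inter> (closure U \<inter> f -` cball y 1)"
  have "compact (closure U \<inter> f -` cball y 1)"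
    using assms(1) by (auto simp: admissible_def proper_on_def)
  then have "compact ?L" by (rule closed_Int_compact[OF assms(2)])
  moreover have "continuous_on ?L (\<lambda>x. norm (f x - y))"
  proof -
    have "continuous_on (closure U) f" using assms(1) by (simp add: admissible_def)
    then have "continuous_on ?L f" by (rule continuous_on_subset) auto
    then show ?thesis by (intro continuous_intros)
  qed
  ultimately obtain e where e: "e > 0" "\<And>x. x \<in> ?L \<Longrightarrow> e \<le> norm (f x - y)"
    using compact_pos_lower_bound[of ?L "\<lambda>x. norm (f x - y)"] assms(4) by auto
  show ?thesis
  proof (rule that[of "min e 1"])
    fix x assume "x \<in> C"
    then show "min e 1 \<le> norm (f x - y)"
      using e(2)[of x] assms(3) by (cases "f x \<in> cball y 1") (auto simp: dist_norm norm_minus_commute)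
  qed (use e in auto)
qed

text \<open>Supplies the compact set \<open>K\<close> for the degree integral on a possibly
  unbounded \<open>U\<close>.\<close>

lemma admissible_compact_sublevel:
  assumes "admissible f U y" "\<And>x. x \<in> frontier U \<Longrightarrow> \<rho> < norm (f x - y)"
  shows "compact (closure U \<inter> f -` cball y \<rho>)" "closure U \<inter> f -` cball y \<rho> \<subseteq> U"
proof -
  show "compact (closure U \<inter> f -` cball y \<rho>)"
    using assms(1) by (auto simp: admissible_def proper_on_def)
  have "x \<in> U" if "x \<in> closure U" "norm (f x - y) \<le> \<rho>" for x
  proof (rule ccontr)
    assume "x \<notin> U"
    then have "x \<in> frontier U"
      using that(1) assms(1) by (simp add: frontier_def interior_open admissible_def)
    then show False using assms(2) that(2) by fastforce
  qed
  then show "closure U \<inter> f -` cball y \<rho> \<subseteq> U"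
    by (auto simp: dist_norm norm_minus_commute)
qed

text \<open>A sum over an infinite set defaults to 0, so finiteness is required before the sum in
  \<open>regular_degree\<close> can be split.\<close>

lemma regular_finite:
  assumes "regular g U z"
  shows "finite (g -` {z} \<inter> U)"
proof -
  have adm: "admissible g U z" and U: "open U" using assms by (auto simp: regular_def admissible_def)
  obtain \<delta> where \<delta>: "\<delta> > 0" "\<And>x. x \<in> frontier U \<Longrightarrow> \<delta> \<le> norm (g x - z)"
    using admissible_lower_bound[OF adm, of "frontier U"] adm
    by (auto simp: admissible_def frontier_def closed_Diff)
  let ?K = "closure U \<inter> g -` cball z (\<delta> / 2)"
  have K: "compact ?K" "?K \<subseteq> U"
    using admissible_compact_sublevel[OF adm, of "\<delta> / 2"] \<delta> by force+
  have "Cn_on 2 U g" using assms U by (simp add: regular_def smooth_on_closure_imp_Cn_on)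
  then have G: "Cn_on 2 U (\<lambda>x. g x - z)" using U by (intro Cn_on_diff Cn_on_const)
  have far: "\<delta> / 2 \<le> norm (g x - z)" if "x \<in> U - ?K" for x
    using that closure_subset[of U] by (auto simp: dist_norm norm_minus_commute)
  have reg: "jacobian_det (\<lambda>x. g x - z) x \<noteq> 0" if "x \<in> U" "g x - z = 0" for x
    using assms that by (simp add: regular_def jacobian_det_diff_const)
  have "finite {x \<in> U. g x - z = 0}"
    using degree_integral_eq_sum_local_index[OF U G K _ far reg] \<delta>(1) by (metis half_gt_zero)
  moreover have "g -` {z} \<inter> U = {x \<in> U. g x - z = 0}" by auto
  ultimately show ?thesis by simp
qed

lemma degree_approxE:
  assumes "degree_approx f U y g z"
  obtains \<eta> where "\<eta> > 0" "\<And>x. x \<in> closure U \<Longrightarrow> norm ((g x - z) - (f x - y)) \<le> \<eta>"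
    "frontier U \<noteq> {} \<Longrightarrow> \<eta> < infdist y (f ` frontier U)"
proof -
  obtain \<epsilon> \<sigma> where *: "\<epsilon> > 0" "\<sigma> > 0" "\<And>x. x \<in> closure U \<Longrightarrow> norm (g x - f x) \<le> \<epsilon>" "norm (z - y) \<le> \<sigma>"
    "frontier U = {} \<or> \<epsilon> + \<sigma> < infdist y (f ` frontier U)"
    using assms unfolding degree_approx_def by blast
  show ?thesis
  proof (rule that[of "\<epsilon> + \<sigma>"])
    fix x assume "x \<in> closure U"
    have "(g x - z) - (f x - y) = (g x - f x) - (z - y)" by simp
    also have "norm \<dots> \<le> norm (g x - f x) + norm (z - y)" by (rule norm_triangle_ineq4)
    also have "\<dots> \<le> \<epsilon> + \<sigma>" using *(3)[OF \<open>x \<in> closure U\<close>] *(4) by simp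
    finally show "norm ((g x - z) - (f x - y)) \<le> \<epsilon> + \<sigma>" .
  qed (use * in auto)
qed

text \<open>Both \<open>g0 - z0\<close> and \<open>g1 - z1\<close> stay within \<open>\<eta>\<close>
  of \<open>f - y\<close>, hence so does every point of the segment between them. Half of the slack
  \<open>\<delta>\<close> keeps the compact sublevel set off the frontier, the other half keeps the
  homotopy away from 0 outside that set.\<close>

lemma regular_degree_unique:
  assumes adm: "admissible f U y"
    and 0: "regular g0 U z0" "degree_approx f U y g0 z0"
    and 1: "regular g1 U z1" "degree_approx f U y g1 z1"
  shows "regular_degree g0 U z0 = regular_degree g1 U z1"
proof -
  have U: "open U" using adm by (simp add: admissible_def)
  obtain \<eta>0 where e0: "\<eta>0 > 0" "\<And>x. x \<in> closure U \<Longrightarrow> norm ((g0 x - z0) - (f x - y)) \<le> \<eta>0"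
    "frontier U \<noteq> {} \<Longrightarrow> \<eta>0 < infdist y (f ` frontier U)" using degree_approxE[OF 0(2)] by metis
  obtain \<eta>1 where e1: "\<eta>1 > 0" "\<And>x. x \<in> closure U \<Longrightarrow> norm ((g1 x - z1) - (f x - y)) \<le> \<eta>1"
    "frontier U \<noteq> {} \<Longrightarrow> \<eta>1 < infdist y (f ` frontier U)" using degree_approxE[OF 1(2)] by metis
  define \<eta> where "\<eta> = max \<eta>0 \<eta>1"
  have eta: "norm ((g0 x - z0) - (f x - y)) \<le> \<eta>" "norm ((g1 x - z1) - (f x - y)) \<le> \<eta>" if "x \<in> closure U" for x
    using e0(2)[OF that] e1(2)[OF that] by (auto simp: \<eta>_def)
  \<comment> \<open>With an empty frontier any positive slack will do, whereas
    \<open>infdist\<close> to the empty set would give 0.\<close>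
  define \<delta> where "\<delta> = (if frontier U = {} then 1 else infdist y (f ` frontier U) - \<eta>)"
  have "\<delta> > 0" using e0(3) e1(3) by (auto simp: \<delta>_def \<eta>_def)
  have front: "\<eta> + \<delta> / 2 < norm (f x - y)" if "x \<in> frontier U" for x
  proof -
    have "infdist y (f ` frontier U) \<le> dist y (f x)" by (intro infdist_le imageI that)
    moreover have "\<eta> + \<delta> = infdist y (f ` frontier U)" using that by (auto simp: \<delta>_def)
    ultimately show ?thesis using \<open>\<delta> > 0\<close> by (simp add: dist_norm norm_minus_commute)
  qed
  let ?K = "closure U \<inter> f -` cball y (\<eta> + \<delta> / 2)"
  note K = admissible_compact_sublevel[OF adm front]
  have far: "\<delta> / 2 \<le> norm ((1 - t) *\<^sub>R (g0 x - z0) + t *\<^sub>R (g1 x - z1))"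
    if x: "x \<in> U - ?K" and t: "t \<in> {0..1}" for x t
  proof -
    let ?h = "(1 - t) *\<^sub>R (g0 x - z0) + t *\<^sub>R (g1 x - z1)"
    have xc: "x \<in> closure U" using x closure_subset by blast
    have "?h - (f x - y) = (1 - t) *\<^sub>R ((g0 x - z0) - (f x - y)) + t *\<^sub>R ((g1 x - z1) - (f x - y))"
      by (simp add: algebra_simps)
    also have "norm \<dots> \<le> (1 - t) * norm ((g0 x - z0) - (f x - y)) + t * norm ((g1 x - z1) - (f x - y))"
      using t norm_triangle_ineq by (metis abs_of_nonneg atLeastAtMost_iff diff_ge_0_iff_ge norm_scaleR)
    also have "\<dots> \<le> (1 - t) * \<eta> + t * \<eta>"
      using t eta[OF xc] by (intro add_mono mult_left_mono) auto
    finally have "norm (?h - (f x - y)) \<le> \<eta>" by (simp add: algebra_simps)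
    moreover have "\<eta> + \<delta> / 2 < norm (f x - y)" using x xc by (auto simp: dist_norm norm_minus_commute)
    moreover have "norm (f x - y) \<le> norm ?h + norm (?h - (f x - y))"
      using norm_triangle_ineq4[of ?h "?h - (f x - y)"] by simp
    ultimately show ?thesis by linarith
  qed
  have Cn: "Cn_on 2 U (\<lambda>x. g x - z)" if "regular g U z" for g z
    using that U by (intro Cn_on_diff Cn_on_const smooth_on_closure_imp_Cn_on) (auto simp: regular_def)
  have reg: "jacobian_det (\<lambda>x. g x - z) x \<noteq> 0" if "regular g U z" "x \<in> U" "g x - z = 0" for g z x
    using that by (simp add: regular_def jacobian_det_diff_const)
  show ?thesis
    unfolding regular_degree_eq_sum_zeros
    by (rule sum_local_index_homotopy_invariant[OF U Cn[OF 0(1)] Cn[OF 1(1)] K _ far reg[OF 0(1)] reg[OF 1(1)]])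
      (use \<open>\<delta> > 0\<close> in auto)
qed

section \<open>Degrees computed from regular approximations\<close>

lemma brouwer_deg_eq_regular_degree:
  assumes "admissible f U y" "regular g U z" "degree_approx f U y g z"
  shows "brouwer_deg f U y = regular_degree g U z"
  unfolding brouwer_deg_def
  by (rule the_equality) (use assms regular_degree_unique in blast)+

text \<open>Where \<open>g\<close> is bounded, so is \<open>f\<close>: preimages of compact sets
  under \<open>g\<close> are closed subsets of compact preimages under \<open>f\<close>.\<close>

lemma proper_on_near:
  assumes "closed X" "proper_on X f" "continuous_on X g" "\<And>x. x \<in> X \<Longrightarrow> norm (g x - f x) \<le> e"
  shows "proper_on X (g :: 'a::metric_space \<Rightarrow> 'b::euclidean_space)"
  unfolding proper_on_def
proof (intro allI impI)
  fix K :: "'b set" assume "compact K"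
  then obtain R where R: "K \<subseteq> cball 0 R"
    using compact_imp_bounded bounded_any_center[of K 0] by (auto simp: subset_iff)
  have "compact (X \<inter> f -` cball 0 (R + e))" using assms(2) by (auto simp: proper_on_def)
  moreover have "closed (X \<inter> g -` K)"
    using assms(1,3) \<open>compact K\<close> by (auto intro: continuous_closed_preimage compact_imp_closed)
  moreover have "X \<inter> g -` K \<subseteq> X \<inter> f -` cball 0 (R + e)"
  proof
    fix x assume x: "x \<in> X \<inter> g -` K"
    have "norm (f x) \<le> norm (g x) + norm (g x - f x)"
      using norm_triangle_ineq4[of "g x" "g x - f x"] by simp
    then show "x \<in> X \<inter> f -` cball 0 (R + e)" using x R assms(4)[of x] by auto
  qed
  ultimately show "compact (X \<inter> g -` K)" by (metis closed_Int_compact inf.absorb_iff1)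
qed

text \<open>Smoothness of \<open>g\<close> and regularity of \<open>z\<close> are asked on the whole
  space, so one pair can serve several open sets or several times. The two quarters add up to
  \<open>\<delta> / 2\<close>, strictly below the frontier distance.\<close>

lemma near_regular:
  assumes adm: "admissible f U y" and g: "\<And>n. Cn_on n UNIV g"
    and near: "\<And>x. x \<in> closure U \<Longrightarrow> norm (g x - f x) \<le> \<delta> / 4" "norm (z - y) \<le> \<delta> / 4"
    and front: "\<And>x. x \<in> frontier U \<Longrightarrow> \<delta> \<le> norm (f x - y)" and "\<delta> > 0"
    and reg: "\<And>x. g x = z \<Longrightarrow> jacobian_det g x \<noteq> 0"
  shows "regular g U z" "brouwer_deg f U y = regular_degree g U z"
proof -
  have contg: "continuous_on UNIV g" using g[of 0] by simp
  have "g x \<noteq> z" if "x \<in> frontier U" for x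
  proof
    assume "g x = z"
    have "x \<in> closure U" using that by (simp add: frontier_def)
    have "norm (f x - y) \<le> norm (f x - g x) + norm (g x - y)"
      using norm_triangle_ineq[of "f x - g x" "g x - y"] by simp
    also have "\<dots> \<le> \<delta> / 4 + \<delta> / 4"
      using near(1)[OF \<open>x \<in> closure U\<close>] near(2) \<open>g x = z\<close> by (simp add: norm_minus_commute)
    finally show False using front[OF that] \<open>\<delta> > 0\<close> by simp
  qed
  moreover have contgU: "continuous_on (closure U) g" using continuous_on_subset[OF contg] by blast
  moreover have "proper_on (closure U) g"
    using proper_on_near[OF closed_closure _ contgU near(1)] adm by (simp add: admissible_def)
  ultimately have "admissible g U z"
    using adm by (simp add: admissible_def)
  moreover have "smooth_on (closure U) g"
    unfolding smooth_on_def using g by (intro exI[of _ UNIV] exI[of _ g]) auto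
  ultimately show r: "regular g U z" using reg by (auto simp: regular_def)
  have "\<delta> \<le> infdist y (f ` frontier U)" if "frontier U \<noteq> {}"
    using that front by (auto simp: infdist_notempty dist_norm norm_minus_commute intro!: cINF_greatest)
  then have "degree_approx f U y g z"
    unfolding degree_approx_def using near \<open>\<delta> > 0\<close>
    by (intro exI[of _ "\<delta> / 4"] conjI) (auto, force)
  then show "brouwer_deg f U y = regular_degree g U z"
    using brouwer_deg_eq_regular_degree[OF adm r] by simp
qed

lemma smooth_approximation_regular_value:
  fixes f :: "real^'k \<Rightarrow> real^'k"
  assumes "closed X" "continuous_on X f" "\<delta> > 0"
  obtains g z where "\<And>n. Cn_on n UNIV g" "\<And>x. x \<in> X \<Longrightarrow> norm (g x - f x) \<le> \<delta>" "norm (z - y) \<le> \<delta>"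
    "\<And>x. g x = z \<Longrightarrow> jacobian_det g x \<noteq> 0"
proof -
  \<comment> \<open>Tietze extends \<open>f\<close> from \<open>X\<close> to the whole space, where
    the smooth approximation lives.\<close>
  obtain F where F: "continuous_on UNIV F" "\<And>x. x \<in> X \<Longrightarrow> F x = f x"
  proof -
    have "closedin (top_of_set UNIV) X" using assms(1) by simp
    from Tietze_unbounded[OF assms(2) this] show ?thesis using that by metis
  qed
  obtain g where g: "\<And>n. Cn_on n UNIV g" "\<And>x. norm (g x - F x) \<le> \<delta>"
    using smooth_approximation[OF F(1) assms(3)] by metis
  have "g differentiable (at x)" for x using g(1)[of "Suc 0"] by simp
  then obtain z where z: "norm (z - y) < \<delta>" "\<And>x. x \<in> UNIV \<Longrightarrow> g x = z \<Longrightarrow> jacobian_det g x \<noteq> 0"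
    using regular_value_near[of UNIV g \<delta> y] assms(3) by metis
  show ?thesis by (rule that[OF g(1), of z]) (use g(2) F(2) z in \<open>auto simp: less_imp_le\<close>, metis)
qed

section \<open>Normalization\<close>

lemma brouwer_deg_identity: "brouwer_deg (\<lambda>x :: real^'k. x) UNIV 0 = 1"
proof -
  have jac: "jacobian_det (\<lambda>x :: real^'k. x) x = 1" for x
    using jacobian_det_affine[of "mat 1 :: real^'k^'k" 0 x] by simp
  have adm: "admissible (\<lambda>x :: real^'k. x) UNIV 0"
    by (simp add: admissible_def proper_on_def)
  have "brouwer_deg (\<lambda>x :: real^'k. x) UNIV 0 = regular_degree (\<lambda>x :: real^'k. x) UNIV 0"
    by (rule near_regular(2)[OF adm, where \<delta> = 1]) (auto simp: jac intro: Cn_on_bounded_linear bounded_linear_ident)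
  also have "\<dots> = 1"
    by (simp add: regular_degree_def local_index_def jac vimage_def)
  finally show ?thesis .
qed

section \<open>Additivity and excision\<close>

lemma admissible_subset:
  assumes "admissible f U y" "open W" "W \<subseteq> U" "\<And>x. x \<in> frontier W \<Longrightarrow> f x \<noteq> y"
  shows "admissible f W y"
proof -
  have sub: "closure W \<subseteq> closure U" using assms(3) by (rule closure_mono)
  have "compact (closure W \<inter> f -` K)" if "compact K" for K
  proof -
    have "closure W \<inter> f -` K = closure W \<inter> (closure U \<inter> f -` K)" using sub by auto
    moreover have "compact (closure U \<inter> f -` K)"
      using assms(1) that by (simp add: admissible_def proper_on_def)
    ultimately show ?thesis by (simp add: closed_Int_compact)
  qed
  moreover have "continuous_on (closure W) f"
    using assms(1) sub by (auto simp: admissible_def intro: continuous_on_subset[of "closure U"])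
  ultimately show ?thesis
    using assms by (auto simp: admissible_def proper_on_def)
qed

text \<open>\<open>C\<close> contains the frontiers of \<open>U\<close>, \<open>U1\<close> and
  \<open>U2\<close> and no solution of \<open>f x = y\<close>, so one \<open>\<delta>\<close> bounds
  all three. A regular pair within \<open>\<delta> / 4\<close> then computes all three degrees and
  has no solutions in \<open>C\<close> either.\<close>

lemma brouwer_deg_additive:
  fixes f :: "real^'k \<Rightarrow> real^'k"
  assumes adm: "admissible f U y" and "open U1" "open U2" "U1 \<subseteq> U" "U2 \<subseteq> U" "U1 \<inter> U2 = {}"
    and zeros: "f -` {y} \<inter> U \<subseteq> U1 \<union> U2"
  shows "brouwer_deg f U y = brouwer_deg f U1 y + brouwer_deg f U2 y"
proof -
  have U: "open U" using adm by (simp add: admissible_def)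
  define C where "C = closure U - (U1 \<union> U2)"
  have C: "closed C" "C \<subseteq> closure U" using assms by (auto simp: C_def intro: closed_Diff)
  have "f x \<noteq> y" if "x \<in> C" for x
    using that adm zeros U by (auto simp: C_def admissible_def frontier_def interior_open)
  then obtain \<delta> where \<delta>: "\<delta> > 0" "\<And>x. x \<in> C \<Longrightarrow> \<delta> \<le> norm (f x - y)"
    using admissible_lower_bound[OF adm C] by metis
  have frontC: "frontier W \<subseteq> C" if "W = U1 \<or> W = U2 \<or> W = U" for W
  proof
    fix x assume x: "x \<in> frontier W"
    have W: "open W" "W \<subseteq> U" using that assms U by auto
    then have "x \<in> closure U" "x \<notin> W" "x \<in> closure W"
      using x closure_mono[of W U] by (auto simp: frontier_def interior_open)
    \<comment> \<open>An open set misses the closure of any set disjoint from it, so frontier points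
      of \<open>U2\<close> do not lie in \<open>U1\<close>, nor conversely.\<close>
    moreover have "x \<notin> closure U2" if "x \<in> U1"
      using that assms(2,6) by (auto simp: closure_iff_nhds_not_empty)
    moreover have "x \<notin> closure U1" if "x \<in> U2"
      using that assms(3,6) by (auto simp: closure_iff_nhds_not_empty)
    ultimately show "x \<in> C" using that assms(4,5) by (auto simp: C_def)
  qed
  obtain g z where g: "\<And>n. Cn_on n UNIV g" "\<And>x. x \<in> closure U \<Longrightarrow> norm (g x - f x) \<le> \<delta> / 4"
    "norm (z - y) \<le> \<delta> / 4" "\<And>x. g x = z \<Longrightarrow> jacobian_det g x \<noteq> 0"
    using smooth_approximation_regular_value[of "closure U" f "\<delta> / 4" y] adm \<delta>(1) by (auto simp: admissible_def)
  have deg: "regular g W z" "brouwer_deg f W y = regular_degree g W z" if "W = U1 \<or> W = U2 \<or> W = U" for W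
  proof -
    have W: "open W" "W \<subseteq> U" using that assms U by auto
    have front: "\<delta> \<le> norm (f x - y)" if "x \<in> frontier W" for x
      using that frontC[OF \<open>W = U1 \<or> W = U2 \<or> W = U\<close>] \<delta>(2) by blast
    have "admissible f W y"
      by (rule admissible_subset[OF adm W]) (use front \<delta>(1) in force)
    from near_regular[OF this g(1) _ g(3) front \<delta>(1) g(4)] closure_mono[OF W(2)] g(2)
    show "regular g W z" "brouwer_deg f W y = regular_degree g W z" by blast+
  qed
  have "g x \<noteq> z" if "x \<in> C" for x
  proof
    assume "g x = z"
    have "norm (f x - y) \<le> norm (f x - g x) + norm (g x - y)"
      using norm_triangle_ineq[of "f x - g x" "g x - y"] by simp
    also have "\<dots> \<le> \<delta> / 4 + \<delta> / 4"
      using g(2)[of x] g(3) that C(2) \<open>g x = z\<close> by (auto simp: norm_minus_commute intro!: add_mono)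
    finally show False using \<delta>(1) \<delta>(2)[OF that] by simp
  qed
  then have split: "g -` {z} \<inter> U = (g -` {z} \<inter> U1) \<union> (g -` {z} \<inter> U2)"
    using assms(4,5) closure_subset[of U] by (auto simp: C_def)
  have "regular_degree g U z = regular_degree g U1 z + regular_degree g U2 z"
    unfolding regular_degree_def split
    using regular_finite[OF deg(1)[of U1]] regular_finite[OF deg(1)[of U2]] assms(6)
    by (intro sum.union_disjoint) auto
  then show ?thesis using deg(2) by simp
qed

text \<open>The empty set splits into two empty sets, which forces degree 0 there; excision is
  additivity with an empty second piece.\<close>

lemma brouwer_deg_excision:
  fixes f :: "real^'k \<Rightarrow> real^'k"
  assumes "admissible f U y" "open W" "W \<subseteq> U" "f -` {y} \<inter> U \<subseteq> W"
  shows "brouwer_deg f U y = brouwer_deg f W y"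
proof -
  have "admissible f {} y" by (simp add: admissible_def proper_on_def)
  then have "brouwer_deg f {} y = brouwer_deg f {} y + brouwer_deg f {} y"
    by (rule brouwer_deg_additive) auto
  then have "brouwer_deg f {} y = 0" by simp
  moreover have "brouwer_deg f U y = brouwer_deg f W y + brouwer_deg f {} y"
    using assms by (intro brouwer_deg_additive) auto
  ultimately show ?thesis by simp
qed

section \<open>Homotopy invariance\<close>

lemma admissible_homotopy_imp_admissible:
  assumes "admissible_homotopy H U \<alpha>" "t \<in> {0..1}"
  shows "admissible (\<lambda>x. H (x, t)) U (\<alpha> t)"
proof -
  have "continuous_on (closure U) (\<lambda>x. H (x, t))"
  proof (rule continuous_on_compose2[of "closure U \<times> {0..1}" H])
    show "continuous_on (closure U) (\<lambda>x. (x, t))" by (intro continuous_intros)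
  qed (use assms in \<open>auto simp: admissible_homotopy_def\<close>)
  moreover have "compact (closure U \<inter> (\<lambda>x. H (x, t)) -` K)" if "compact K" for K
  proof -
    have "compact (closure U \<times> {0..1} \<inter> H -` K)"
      using assms(1) that by (simp add: admissible_homotopy_def proper_on_def)
    then have "compact ((closure U \<times> {0..1} \<inter> H -` K) \<inter> (UNIV \<times> {t}))"
      by (rule compact_Int_closed) (intro closed_Times closed_UNIV closed_singleton)
    then have "compact (fst ` ((closure U \<times> {0..1} \<inter> H -` K) \<inter> (UNIV \<times> {t})))"
      by (intro compact_continuous_image continuous_on_fst continuous_on_id)
    moreover have "fst ` ((closure U \<times> {0..1} \<inter> H -` K) \<inter> (UNIV \<times> {t})) = closure U \<inter> (\<lambda>x. H (x, t)) -` K"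
      using assms(2) by force
    ultimately show ?thesis by simp
  qed
  ultimately show ?thesis
    using assms by (auto simp: admissible_homotopy_def admissible_def proper_on_def)
qed

lemma compact_open_bounded_between:
  fixes P :: "'a::metric_space set"
  assumes "compact P" "open U" "P \<subseteq> U"
  obtains W where "open W" "bounded W" "P \<subseteq> W" "closure W \<subseteq> U"
proof -
  obtain e where e: "e > 0" "(\<Union>x\<in>P. ball x e) \<subseteq> U"
    using compact_subset_open_imp_ball_epsilon_subset[OF assms] by metis
  \<comment> \<open>Half of \<open>e\<close>, so that the closure of \<open>W\<close> still lies
    within the \<open>e\<close>-balls around \<open>P\<close>.\<close>
  let ?W = "\<Union>x\<in>P. ball x (e / 2)"
  obtain a R where R: "P \<subseteq> cball a R" using compact_imp_bounded[OF assms(1)] by (auto simp: bounded_subset_cball)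
  show ?thesis
  proof (rule that[of ?W])
    have "?W \<subseteq> cball a (R + e / 2)"
    proof
      fix w assume "w \<in> ?W"
      then obtain x where "x \<in> P" "dist x w < e / 2" by auto
      then show "w \<in> cball a (R + e / 2)" using R dist_triangle[of a w x] by force
    qed
    then show "bounded ?W" using bounded_cball bounded_subset by blast
    show "closure ?W \<subseteq> U"
    proof
      fix w assume "w \<in> closure ?W"
      then obtain v where v: "v \<in> ?W" "dist v w < e / 2" using e(1) closure_approachable[of w ?W] by (metis half_gt_zero)
      then obtain x where "x \<in> P" "dist x v < e / 2" by auto
      then have "w \<in> ball x e" using v dist_triangle[of x w v] by simp
      then show "w \<in> U" using e(2) \<open>x \<in> P\<close> by blast
    qed
  qed (use e in auto)
qed

text \<open>For nearby times one regular pair approximates both slices and computes both degrees.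
  Boundedness gives a frontier bound uniform in time and uniform continuity of \<open>H\<close>,
  hence one step length for the whole unit interval.\<close>

lemma brouwer_deg_homotopy_invariant_bounded:
  fixes H :: "(real^'k) \<times> real \<Rightarrow> real^'k"
  assumes hom: "admissible_homotopy H U \<alpha>" and "bounded U"
  shows "brouwer_deg (\<lambda>x. H (x, 0)) U (\<alpha> 0) = brouwer_deg (\<lambda>x. H (x, 1)) U (\<alpha> 1)"
proof -
  let ?D = "\<lambda>t. brouwer_deg (\<lambda>x. H (x, t)) U (\<alpha> t)"
  have contH: "continuous_on (closure U \<times> {0..1}) H" and cont\<alpha>: "continuous_on {0..1} \<alpha>"
    using hom by (auto simp: admissible_homotopy_def path_def)
  have cU: "compact (closure U)" using \<open>bounded U\<close> by simp
  have cF: "compact (frontier U)" using \<open>bounded U\<close> by (simp add: compact_frontier_bounded)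
  have "continuous_on (frontier U \<times> {0..1}) H"
    by (rule continuous_on_subset[OF contH]) (auto simp: frontier_def)
  moreover have "continuous_on (frontier U \<times> {0..1}) (\<lambda>p. \<alpha> (snd p))"
    by (rule continuous_on_compose2[OF cont\<alpha>]) (auto intro: continuous_on_snd continuous_on_id)
  ultimately have "continuous_on (frontier U \<times> {0..1}) (\<lambda>p. norm (H p - \<alpha> (snd p)))"
    by (intro continuous_on_norm continuous_on_diff)
  moreover have "norm (H p - \<alpha> (snd p)) > 0" if "p \<in> frontier U \<times> {0..1}" for p
    using hom that by (auto simp: admissible_homotopy_def)
  ultimately obtain \<delta> where \<delta>: "\<delta> > 0" "\<And>p. p \<in> frontier U \<times> {0..1} \<Longrightarrow> \<delta> \<le> norm (H p - \<alpha> (snd p))"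
    using compact_pos_lower_bound[OF compact_Times[OF cF compact_Icc], of 0 1 "\<lambda>p. norm (H p - \<alpha> (snd p))"]
    by blast
  have "uniformly_continuous_on (closure U \<times> {0..1}) H"
    by (intro compact_uniformly_continuous contH compact_Times cU) simp
  then obtain d1 where d1: "d1 > 0" "\<And>p q. p \<in> closure U \<times> {0..1} \<Longrightarrow> q \<in> closure U \<times> {0..1} \<Longrightarrow>
      dist q p < d1 \<Longrightarrow> dist (H q) (H p) < \<delta> / 8"
    using \<delta>(1) unfolding uniformly_continuous_on_def by (metis zero_less_divide_iff zero_less_numeral)
  have "uniformly_continuous_on {0..1} \<alpha>"
    by (intro compact_uniformly_continuous cont\<alpha>) simp
  then obtain d2 where d2: "d2 > 0" "\<And>s t. s \<in> {0..1} \<Longrightarrow> t \<in> {0..1} \<Longrightarrow>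
      dist t s < d2 \<Longrightarrow> dist (\<alpha> t) (\<alpha> s) < \<delta> / 8"
    using \<delta>(1) unfolding uniformly_continuous_on_def by (metis zero_less_divide_iff zero_less_numeral)
  have step: "?D s = ?D t" if st: "s \<in> {0..1}" "t \<in> {0..1}" "\<bar>s - t\<bar> < min d1 d2" for s t
  proof -
    have "continuous_on (closure U) (\<lambda>x. H (x, s))"
      using admissible_homotopy_imp_admissible[OF hom st(1)] by (simp add: admissible_def)
    \<comment> \<open>An eighth for the approximation at time \<open>s\<close> and an eighth for the
      move to time \<open>t\<close> make up the quarter allowed by
      \<open>near_regular\<close>.\<close>
    then obtain g z where g: "\<And>n. Cn_on n UNIV g" "\<And>x. x \<in> closure U \<Longrightarrow> norm (g x - H (x, s)) \<le> \<delta> / 8"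
      "norm (z - \<alpha> s) \<le> \<delta> / 8" "\<And>x. g x = z \<Longrightarrow> jacobian_det g x \<noteq> 0"
      using smooth_approximation_regular_value[of "closure U" "\<lambda>x. H (x, s)" "\<delta> / 8" "\<alpha> s"] \<delta>(1) by auto
    have "?D r = regular_degree g U z" if r: "r = s \<or> r = t" for r
    proof (rule near_regular(2)[OF admissible_homotopy_imp_admissible[OF hom] g(1)])
      show "r \<in> {0..1}" using r st by auto
      show "norm (g x - H (x, r)) \<le> \<delta> / 4" if x: "x \<in> closure U" for x
      proof -
        have "dist (H (x, s)) (H (x, r)) \<le> \<delta> / 8"
        proof (cases "r = s")
          case False
          then have "dist (x, s) (x, t) < d1" using st by (simp add: dist_Pair_Pair dist_real_def)
          then show ?thesis using d1(2)[of "(x, t)" "(x, s)"] r False st x by (simp add: less_imp_le)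
        qed (use \<delta>(1) in simp)
        then show ?thesis
          using g(2)[OF x] norm_triangle_ineq[of "g x - H (x, s)" "H (x, s) - H (x, r)"] by (simp add: dist_norm)
      qed
      have "dist (\<alpha> s) (\<alpha> r) \<le> \<delta> / 8"
        using r st d2(2)[of t s] \<delta>(1) by (auto simp: dist_real_def less_imp_le)
      then show "norm (z - \<alpha> r) \<le> \<delta> / 4"
        using g(3) norm_triangle_ineq[of "z - \<alpha> s" "\<alpha> s - \<alpha> r"] by (simp add: dist_norm)
      show "\<delta> \<le> norm (H (x, r) - \<alpha> r)" if "x \<in> frontier U" for x
        using \<delta>(2)[of "(x, r)"] that r st by auto
    qed (use \<delta>(1) g(4) in auto)
    then show ?thesis by simp
  qed
  obtain N where N: "inverse (real (Suc N)) < min d1 d2"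
    using reals_Archimedean[of "min d1 d2"] d1(1) d2(1) by auto
  have "?D (real k / real (Suc N)) = ?D 0" if "k \<le> Suc N" for k
    using that
  proof (induction k)
    case (Suc k)
    have "?D (real (Suc k) / real (Suc N)) = ?D (real k / real (Suc N))"
    proof (rule step)
      have "real (Suc k) / real (Suc N) - real k / real (Suc N) = inverse (real (Suc N))"
        by (simp add: field_simps)
      then show "\<bar>real (Suc k) / real (Suc N) - real k / real (Suc N)\<bar> < min d1 d2" using N by simp
    qed (use Suc.prems in \<open>auto simp: divide_le_eq_1\<close>)
    then show ?case using Suc by simp
  qed simp
  from this[of "Suc N"] show ?thesis by simp
qed

text \<open>On an unbounded \<open>U\<close> uniform continuity may fail. The solutions at all times
  lie over the compact \<open>?P\<close>, so \<open>U\<close> can be replaced by a bounded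
  neighbourhood \<open>W\<close> of it without changing the degree of any slice.\<close>

lemma brouwer_deg_homotopy_invariant:
  fixes H :: "(real^'k) \<times> real \<Rightarrow> real^'k"
  assumes hom: "admissible_homotopy H U \<alpha>"
  shows "brouwer_deg (\<lambda>x. H (x, 0)) U (\<alpha> 0) = brouwer_deg (\<lambda>x. H (x, 1)) U (\<alpha> 1)"
proof -
  have U: "open U" and contH: "continuous_on (closure U \<times> {0..1}) H" and cont\<alpha>: "continuous_on {0..1} \<alpha>"
    and proper: "proper_on (closure U \<times> {0..1}) H"
    and front: "\<And>x t. x \<in> frontier U \<Longrightarrow> t \<in> {0..1} \<Longrightarrow> H (x, t) \<noteq> \<alpha> t"
    using hom by (auto simp: admissible_homotopy_def path_def)
  let ?X = "closure U \<times> {0..1::real}"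
  have "continuous_on ?X (\<lambda>p. \<alpha> (snd p))"
    by (rule continuous_on_compose2[OF cont\<alpha>]) (auto intro: continuous_on_snd continuous_on_id)
  then have "closed (?X \<inter> (\<lambda>p. H p - \<alpha> (snd p)) -` {0})"
    by (intro continuous_closed_preimage continuous_on_diff contH closed_Times) auto
  \<comment> \<open>Properness is given for \<open>H\<close> and not for
    \<open>H - \<alpha>\<close>; the compact image of the path takes in all target values at
    once.\<close>
  moreover have "compact (?X \<inter> H -` (\<alpha> ` {0..1}))"
    using proper compact_continuous_image[OF cont\<alpha>] by (simp add: proper_on_def)
  moreover have "?X \<inter> (\<lambda>p. H p - \<alpha> (snd p)) -` {0} \<subseteq> ?X \<inter> H -` (\<alpha> ` {0..1})" by auto
  ultimately have "compact (?X \<inter> (\<lambda>p. H p - \<alpha> (snd p)) -` {0})"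
    using closed_Int_compact[of "?X \<inter> (\<lambda>p. H p - \<alpha> (snd p)) -` {0}" "?X \<inter> H -` (\<alpha> ` {0..1})"]
    by (simp only: inf.absorb1)
  then have P: "compact (fst ` (?X \<inter> (\<lambda>p. H p - \<alpha> (snd p)) -` {0}))" (is "compact ?P")
    by (intro compact_continuous_image continuous_on_fst continuous_on_id)
  have "x \<in> U" if "x \<in> closure U" "t \<in> {0..1}" "H (x, t) = \<alpha> t" for x t
    using that front[of x t] U by (auto simp: frontier_def interior_open)
  then have PU: "?P \<subseteq> U" by auto
  obtain W where W: "open W" "bounded W" "?P \<subseteq> W" "closure W \<subseteq> U"
    by (rule compact_open_bounded_between[OF P U PU])
  have zeros: "x \<in> W" if "x \<in> closure U" "t \<in> {0..1}" "H (x, t) = \<alpha> t" for x t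
  proof -
    have "x \<in> ?P" using that by (intro image_eqI[of _ _ "(x, t)"]) auto
    then show ?thesis using W(3) by blast
  qed
  have WU: "W \<subseteq> U" "closure W \<subseteq> closure U" using W(4) closure_subset by blast+
  have "proper_on (closure W \<times> {0..1}) H"
    unfolding proper_on_def
  proof (intro allI impI)
    fix K :: "(real^'k) set" assume "compact K"
    have "closure W \<times> {0..1} \<inter> H -` K = (closure W \<times> {0..1}) \<inter> (?X \<inter> H -` K)" using WU by auto
    moreover have "compact (?X \<inter> H -` K)" using proper \<open>compact K\<close> by (simp add: proper_on_def)
    moreover have "closed (closure W \<times> {0..1::real})" by (intro closed_Times) auto
    ultimately show "compact (closure W \<times> {0..1} \<inter> H -` K)" by (simp only: closed_Int_compact)
  qed
  moreover have "continuous_on (closure W \<times> {0..1}) H"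
    using WU by (auto intro: continuous_on_subset[OF contH])
  moreover have "H (x, t) \<noteq> \<alpha> t" if "x \<in> frontier W" "t \<in> {0..1}" for x t
    using that zeros[of x t] WU W(1) by (auto simp: frontier_def interior_open)
  ultimately have homW: "admissible_homotopy H W \<alpha>"
    using hom W(1) by (auto simp: admissible_homotopy_def)
  have "brouwer_deg (\<lambda>x. H (x, t)) U (\<alpha> t) = brouwer_deg (\<lambda>x. H (x, t)) W (\<alpha> t)" if t: "t \<in> {0..1}" for t
    using zeros[OF _ t] WU W(1) closure_subset[of U]
    by (intro brouwer_deg_excision admissible_homotopy_imp_admissible[OF hom t]) auto
  then show ?thesis
    using brouwer_deg_homotopy_invariant_bounded[OF homW W(2)] by simp
qed

theorem theorem3p9:
  shows "brouwer_deg (\<lambda>x :: real ^ 'k. x) UNIV 0 = 1 \<and>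
    (\<forall>(f :: real ^ 'k \<Rightarrow> real ^ 'k) U y U1 U2.
       admissible f U y \<and> open U1 \<and> open U2 \<and> U1 \<subseteq> U \<and> U2 \<subseteq> U \<and> U1 \<inter> U2 = {} \<and>
       f -` {y} \<inter> U \<subseteq> U1 \<union> U2 \<longrightarrow>
       brouwer_deg f U y = brouwer_deg f U1 y + brouwer_deg f U2 y) \<and>
    (\<forall>(H :: (real ^ 'k) \<times> real \<Rightarrow> real ^ 'k) U \<alpha>.
       admissible_homotopy H U \<alpha> \<longrightarrow>
       brouwer_deg (\<lambda>x. H (x, 0)) U (\<alpha> 0) = brouwer_deg (\<lambda>x. H (x, 1)) U (\<alpha> 1))"
  using brouwer_deg_identity brouwer_deg_additive brouwer_deg_homotopy_invariant by blast

end
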